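(* Let $G=(V,E)$ be a finite multigraph (loops allowed). The following are equivalent: (1) $G$ is a $P(2,1)$-graph; (2) $G$ can be constructed from $K_1^1$ or from $K_2^3$ by a finite sequence of 1a, 1b, 2a and 2b moves; (3) $E$ is the disjoint union of the edge sets of a spanning tree $T$ of $G$ and a connected spanning map-graph $M$ of $G$.
   Context: $K_1^1$ is a single vertex with one loop; $K_2^3$ is two vertices with three parallel edges. A graph is $(k,\ell)$-sparse if every subgraph $(V',E')$ with at least one edge has $|E'|\le k|V'|-\ell$, and $(k,\ell)$-tight if also $|E|=k|V|-\ell$. A $P(2,1)$-graph is a $(2,1)$-tight graph $G$ such that $G-e$ is $(2,2)$-tight for some edge $e$. A map-graph is a graph each of whose connected components contains exactly one cycle (a loop counts as a cycle). Moves: (1a) add a new vertex $v_0$ joined by one edge to each of two distinct existing vertices $v_1,v_2$; (1b) add a new vertex $v_0$ joined by two parallel edges to one existing vertex $v_1$; (2a) remove an edge $v_1v_2$ with $v_1\ne v_2$ and add a new vertex $v_0$ joined by one edge to each of $v_1,v_2,v_3$, where $v_3$ is an existing vertex distinct from $v_1,v_2$; (2b) remove an edge $v_1v_2$ with $v_1\ne v_2$ and add a new vertex $v_0$ joined by one edge to $v_1$ and two parallel edges to $v_2$. *)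

theory Defs
  imports Main
begin

text \<open>Undirected multigraphs with labelled edges; an edge \<open>e\<close> is a loop iff \<open>ends e\<close> is a singleton.
  The value of \<open>ends\<close> outside \<open>edges\<close> is irrelevant.\<close>

record ('v, 'e) mgraph =
  verts :: "'v set"
  edges :: "'e set"
  ends :: "'e \<Rightarrow> 'v set"

definition multigraph :: "('v, 'e) mgraph \<Rightarrow> bool" where
  "multigraph G \<longleftrightarrow> (\<forall>e\<in>edges G. \<exists>u\<in>verts G. \<exists>v\<in>verts G. ends G e = {u, v})"

definition finite_multigraph :: "('v, 'e) mgraph \<Rightarrow> bool" where
  "finite_multigraph G \<longleftrightarrow> multigraph G \<and> finite (verts G) \<and> finite (edges G)"

definition subgraph :: "('v, 'e) mgraph \<Rightarrow> ('v, 'e) mgraph \<Rightarrow> bool" where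
  "subgraph H G \<longleftrightarrow>
     multigraph H \<and> verts H \<subseteq> verts G \<and> edges H \<subseteq> edges G \<and> ends H = ends G"

definition spanning_subgraph :: "('v, 'e) mgraph \<Rightarrow> ('v, 'e) mgraph \<Rightarrow> bool" where
  "spanning_subgraph H G \<longleftrightarrow> subgraph H G \<and> verts H = verts G"

definition delete_edge :: "('v, 'e) mgraph \<Rightarrow> 'e \<Rightarrow> ('v, 'e) mgraph" where
  "delete_edge G e = G\<lparr>edges := edges G - {e}\<rparr>"

definition sparse :: "nat \<Rightarrow> nat \<Rightarrow> ('v, 'e) mgraph \<Rightarrow> bool" where
  "sparse k l G \<longleftrightarrow>
     (\<forall>H. subgraph H G \<and> edges H \<noteq> {} \<longrightarrow>
        int (card (edges H)) \<le> int k * int (card (verts H)) - int l)"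

definition tight :: "nat \<Rightarrow> nat \<Rightarrow> ('v, 'e) mgraph \<Rightarrow> bool" where
  "tight k l G \<longleftrightarrow>
     sparse k l G \<and> int (card (edges G)) = int k * int (card (verts G)) - int l"

definition P21_graph :: "('v, 'e) mgraph \<Rightarrow> bool" where
  "P21_graph G \<longleftrightarrow> tight 2 1 G \<and> (\<exists>e\<in>edges G. tight 2 2 (delete_edge G e))"

definition adjacent :: "('v, 'e) mgraph \<Rightarrow> 'v \<Rightarrow> 'v \<Rightarrow> bool" where
  "adjacent G u v \<longleftrightarrow> (\<exists>e\<in>edges G. ends G e = {u, v})"

text \<open>The graph without vertices is not regarded as connected.\<close>

definition connected_graph :: "('v, 'e) mgraph \<Rightarrow> bool" where
  "connected_graph G \<longleftrightarrow>
     verts G \<noteq> {} \<and> (\<forall>u\<in>verts G. \<forall>v\<in>verts G. (adjacent G)\<^sup>*\<^sup>* u v)"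

definition component_of :: "('v, 'e) mgraph \<Rightarrow> ('v, 'e) mgraph \<Rightarrow> bool" where
  "component_of H G \<longleftrightarrow>
     subgraph H G \<and> connected_graph H \<and>
     (\<forall>H'. subgraph H' G \<and> connected_graph H' \<and> subgraph H H' \<longrightarrow> H' = H)"

text \<open>A cycle is identified with its set of edges. Length 1 is a loop, length 2 a pair of
  parallel edges.\<close>

definition cycle_in :: "('v, 'e) mgraph \<Rightarrow> 'e set \<Rightarrow> bool" where
  "cycle_in G C \<longleftrightarrow>
     (\<exists>vs es. vs \<noteq> [] \<and> length es = length vs \<and> distinct vs \<and> distinct es \<and>
        set vs \<subseteq> verts G \<and> set es \<subseteq> edges G \<and>
        (\<forall>i<length vs. ends G (es ! i) = {vs ! i, vs ! (Suc i mod length vs)}) \<and>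
        C = set es)"

definition tree :: "('v, 'e) mgraph \<Rightarrow> bool" where
  "tree T \<longleftrightarrow> connected_graph T \<and> (\<nexists>C. cycle_in T C)"

definition map_graph :: "('v, 'e) mgraph \<Rightarrow> bool" where
  "map_graph M \<longleftrightarrow> (\<forall>H. component_of H M \<longrightarrow> (\<exists>!C. cycle_in H C))"

definition is_K11 :: "('v, 'e) mgraph \<Rightarrow> bool" where
  "is_K11 G \<longleftrightarrow> (\<exists>v e. verts G = {v} \<and> edges G = {e} \<and> ends G e = {v})"

definition is_K23 :: "('v, 'e) mgraph \<Rightarrow> bool" where
  "is_K23 G \<longleftrightarrow>
     (\<exists>u v e1 e2 e3. u \<noteq> v \<and> distinct [e1, e2, e3] \<and>
        verts G = {u, v} \<and> edges G = {e1, e2, e3} \<and>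
        ends G e1 = {u, v} \<and> ends G e2 = {u, v} \<and> ends G e3 = {u, v})"

text \<open>The moves are relations between labelled graphs, each determining its result up to the
  labels of the new vertex and the new edges. In the moves that remove an edge \<open>e\<close>, the label \<open>e\<close>
  may be reused for a new edge; hence the construction does not need more labels than the final
  graph has edges, and the edge type need not be infinite.\<close>

definition move_1a :: "('v, 'e) mgraph \<Rightarrow> ('v, 'e) mgraph \<Rightarrow> bool" where
  "move_1a G G' \<longleftrightarrow>
     (\<exists>v0 v1 v2 f1 f2.
        v0 \<notin> verts G \<and> v1 \<in> verts G \<and> v2 \<in> verts G \<and> v1 \<noteq> v2 \<and>
        distinct [f1, f2] \<and> {f1, f2} \<inter> edges G = {} \<and>
        verts G' = insert v0 (verts G) \<and>
        edges G' = edges G \<union> {f1, f2} \<and>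
        (\<forall>f\<in>edges G. ends G' f = ends G f) \<and>
        ends G' f1 = {v0, v1} \<and> ends G' f2 = {v0, v2})"

definition move_1b :: "('v, 'e) mgraph \<Rightarrow> ('v, 'e) mgraph \<Rightarrow> bool" where
  "move_1b G G' \<longleftrightarrow>
     (\<exists>v0 v1 f1 f2.
        v0 \<notin> verts G \<and> v1 \<in> verts G \<and>
        distinct [f1, f2] \<and> {f1, f2} \<inter> edges G = {} \<and>
        verts G' = insert v0 (verts G) \<and>
        edges G' = edges G \<union> {f1, f2} \<and>
        (\<forall>f\<in>edges G. ends G' f = ends G f) \<and>
        ends G' f1 = {v0, v1} \<and> ends G' f2 = {v0, v1})"

definition move_2a :: "('v, 'e) mgraph \<Rightarrow> ('v, 'e) mgraph \<Rightarrow> bool" where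
  "move_2a G G' \<longleftrightarrow>
     (\<exists>v0 v1 v2 v3 e f1 f2 f3.
        v0 \<notin> verts G \<and> v1 \<in> verts G \<and> v2 \<in> verts G \<and> v3 \<in> verts G \<and> distinct [v1, v2, v3] \<and>
        e \<in> edges G \<and> ends G e = {v1, v2} \<and>
        distinct [f1, f2, f3] \<and> {f1, f2, f3} \<inter> (edges G - {e}) = {} \<and>
        verts G' = insert v0 (verts G) \<and>
        edges G' = (edges G - {e}) \<union> {f1, f2, f3} \<and>
        (\<forall>f\<in>edges G - {e}. ends G' f = ends G f) \<and>
        ends G' f1 = {v0, v1} \<and> ends G' f2 = {v0, v2} \<and> ends G' f3 = {v0, v3})"

definition move_2b :: "('v, 'e) mgraph \<Rightarrow> ('v, 'e) mgraph \<Rightarrow> bool" where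
  "move_2b G G' \<longleftrightarrow>
     (\<exists>v0 v1 v2 e f1 f2 f3.
        v0 \<notin> verts G \<and> v1 \<in> verts G \<and> v2 \<in> verts G \<and> v1 \<noteq> v2 \<and>
        e \<in> edges G \<and> ends G e = {v1, v2} \<and>
        distinct [f1, f2, f3] \<and> {f1, f2, f3} \<inter> (edges G - {e}) = {} \<and>
        verts G' = insert v0 (verts G) \<and>
        edges G' = (edges G - {e}) \<union> {f1, f2, f3} \<and>
        (\<forall>f\<in>edges G - {e}. ends G' f = ends G f) \<and>
        ends G' f1 = {v0, v1} \<and> ends G' f2 = {v0, v2} \<and> ends G' f3 = {v0, v2})"

definition move :: "('v, 'e) mgraph \<Rightarrow> ('v, 'e) mgraph \<Rightarrow> bool" where
  "move G G' \<longleftrightarrow> move_1a G G' \<or> move_1b G G' \<or> move_2a G G' \<or> move_2b G G'"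

definition constructible :: "('v, 'e) mgraph \<Rightarrow> bool" where
  "constructible G \<longleftrightarrow> (\<exists>G0. (is_K11 G0 \<or> is_K23 G0) \<and> move\<^sup>*\<^sup>* G0 G)"

definition tree_map_decomposable :: "('v, 'e) mgraph \<Rightarrow> bool" where
  "tree_map_decomposable G \<longleftrightarrow>
     (\<exists>T M. spanning_subgraph T G \<and> tree T \<and>
        spanning_subgraph M G \<and> connected_graph M \<and> map_graph M \<and>
        edges T \<inter> edges M = {} \<and> edges T \<union> edges M = edges G)"

end

theory Submission
  imports Defs
begin

text \<open>All three conditions say that \<open>G\<close> is the union of two edge-disjoint spanning trees and one
  further edge \<open>e\<close>: deleting an edge of the unique cycle of the map-graph leaves a tree, and each
  move extends or subdivides the two trees and the edge. A tree is (1,1)-tight, because growing a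
  vertex set \<open>S\<close> to all vertices uses a new edge not induced by \<open>S\<close> for each vertex; hence a union
  of two edge-disjoint spanning trees is (2,2)-tight.

  Conversely, if \<open>G - e\<close> is (2,2)-tight with at least two vertices, degree counting gives a vertex
  \<open>v\<close> of degree 2 or 3 off \<open>e\<close>, or both ends of \<open>e\<close> have degree 2 in \<open>G - e\<close>. In the first case
  \<open>v\<close> can be removed, after joining a suitable pair of its neighbours if the degree is 3. In the
  second case an end of \<open>e\<close> can be removed and a new edge between two of its neighbours takes the
  place of \<open>e\<close>, unless all its edges are parallel, and then \<open>G\<close> is \<open>K\<^sub>2\<^sup>3\<close>.\<close>

section \<open>Finite multigraphs\<close>

definition induced_edges :: "('v, 'e) mgraph \<Rightarrow> 'v set \<Rightarrow> 'e set" where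
  "induced_edges G S = {e \<in> edges G. ends G e \<subseteq> S}"

definition incident :: "('v, 'e) mgraph \<Rightarrow> 'v \<Rightarrow> 'e set" where
  "incident G v = {e \<in> edges G. v \<in> ends G e}"

lemma card_eq_card_Diff_plus:
  assumes "finite A" "B \<subseteq> A"
  shows "card A = card (A - B) + card B"
  using assms by (simp add: card_Diff_subset card_mono finite_subset)

lemma finite_multigraphD:
  assumes "finite_multigraph G"
  shows "multigraph G" "finite (verts G)" "finite (edges G)"
  using assms by (auto simp: finite_multigraph_def)

lemma finite_induced_edges: "finite_multigraph G \<Longrightarrow> finite (induced_edges G S)"
  by (simp add: induced_edges_def finite_multigraphD)

lemma finite_incident: "finite_multigraph G \<Longrightarrow> finite (incident G v)"
  by (simp add: incident_def finite_multigraphD)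

lemma multigraph_ends:
  assumes "multigraph G" "e \<in> edges G"
  obtains u v where "u \<in> verts G" "v \<in> verts G" "ends G e = {u, v}"
  using assms by (auto simp: multigraph_def)

lemma multigraph_ends_subset: "multigraph G \<Longrightarrow> e \<in> edges G \<Longrightarrow> ends G e \<subseteq> verts G"
  by (auto elim: multigraph_ends)

lemma incident_other_end:
  assumes "multigraph G" "e \<in> incident G v"
  obtains x where "x \<in> verts G" "ends G e = {v, x}"
proof -
  have e: "e \<in> edges G" "v \<in> ends G e" using assms(2) by (auto simp: incident_def)
  obtain p q where pq: "p \<in> verts G" "q \<in> verts G" "ends G e = {p, q}"
    using multigraph_ends[OF assms(1) e(1)] .
  consider "v = p" | "v = q" using e(2) pq(3) by blast
  then show ?thesis using that pq by cases (auto simp: insert_commute)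
qed

lemma delete_edge_simps [simp]:
  "verts (delete_edge G e) = verts G"
  "edges (delete_edge G e) = edges G - {e}"
  "ends (delete_edge G e) = ends G"
  "(delete_edge G e)\<lparr>edges := A\<rparr> = G\<lparr>edges := A\<rparr>"
  by (simp_all add: delete_edge_def)

lemma finite_multigraph_edges_update:
  "finite_multigraph G \<Longrightarrow> A \<subseteq> edges G \<Longrightarrow> finite_multigraph (G\<lparr>edges := A\<rparr>)"
  by (auto simp: finite_multigraph_def multigraph_def intro: finite_subset)

lemma finite_multigraph_delete_edge:
  "finite_multigraph G \<Longrightarrow> finite_multigraph (delete_edge G e)"
  by (auto simp: delete_edge_def intro: finite_multigraph_edges_update)

lemma card_edges_delete_edge:
  "finite_multigraph G \<Longrightarrow> e \<in> edges G \<Longrightarrow> card (edges G) = Suc (card (edges (delete_edge G e)))"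
  unfolding delete_edge_simps by (rule card.remove[OF finite_multigraphD(3)])

section \<open>Connectivity\<close>

lemma adjacent_commute: "adjacent G u v \<longleftrightarrow> adjacent G v u"
  by (simp add: adjacent_def insert_commute)

lemma reachable_commute: "(adjacent G)\<^sup>*\<^sup>* u v \<longleftrightarrow> (adjacent G)\<^sup>*\<^sup>* v u"
proof -
  have "symp (adjacent G)" by (simp add: symp_def adjacent_commute)
  then show ?thesis by (meson sympD symp_rtranclp)
qed

lemma reachable_ends: "e \<in> edges G \<Longrightarrow> ends G e = {x, y} \<Longrightarrow> (adjacent G)\<^sup>*\<^sup>* x y"
  unfolding adjacent_def by (rule r_into_rtranclp) blast

lemma reachable_mono:
  assumes "(adjacent G)\<^sup>*\<^sup>* u v"
    and "\<And>e x y. e \<in> edges G \<Longrightarrow> ends G e = {x, y} \<Longrightarrow> (adjacent G')\<^sup>*\<^sup>* x y"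
  shows "(adjacent G')\<^sup>*\<^sup>* u v"
  using assms(1)
proof (induction rule: rtranclp_induct)
  case (step y z)
  then show ?case using assms(2) unfolding adjacent_def by (meson rtranclp_trans)
qed simp

lemma connected_graph_from_root:
  assumes "r \<in> verts G" "\<And>v. v \<in> verts G \<Longrightarrow> (adjacent G)\<^sup>*\<^sup>* v r"
  shows "connected_graph G"
  unfolding connected_graph_def
  using assms by (metis empty_iff reachable_commute rtranclp_trans)

lemma connected_graph_mono:
  assumes "connected_graph G" "verts G' = verts G"
    and "\<And>e x y. e \<in> edges G \<Longrightarrow> ends G e = {x, y} \<Longrightarrow> (adjacent G')\<^sup>*\<^sup>* x y"
  shows "connected_graph G'"
  using assms reachable_mono[of G _ _ G'] unfolding connected_graph_def by metis

lemma connected_graph_insert_vertex: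
  assumes "connected_graph G" "verts G' = insert v (verts G)" "x \<in> verts G" "adjacent G' v x"
    and "\<And>e x y. e \<in> edges G \<Longrightarrow> ends G e = {x, y} \<Longrightarrow> (adjacent G')\<^sup>*\<^sup>* x y"
  shows "connected_graph G'"
proof (rule connected_graph_from_root)
  show "x \<in> verts G'" using assms(2,3) by simp
  fix u assume "u \<in> verts G'"
  then consider "u = v" | "(adjacent G)\<^sup>*\<^sup>* u x"
    using assms(1-3) by (auto simp: connected_graph_def)
  then show "(adjacent G')\<^sup>*\<^sup>* u x"
    using assms(4) reachable_mono[OF _ assms(5)] by cases auto
qed

lemma reachable_leaves_set:
  assumes "(adjacent G)\<^sup>*\<^sup>* u v" "u \<in> S" "v \<notin> S"
  shows "\<exists>x\<in>S. \<exists>y. y \<notin> S \<and> adjacent G x y"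
  using assms by (induction rule: rtranclp_induct) auto

lemma connected_graph_crossing_edge:
  assumes "connected_graph G" "multigraph G" "S \<subset> verts G" "S \<noteq> {}"
  obtains e x y where "e \<in> edges G" "ends G e = {x, y}" "x \<in> S" "y \<in> verts G - S"
proof -
  obtain u v where "u \<in> S" "v \<in> verts G - S" using assms(3,4) by blast
  then obtain x y where "x \<in> S" "y \<notin> S" "adjacent G x y"
    using assms(1,3) reachable_leaves_set[of G u v S] unfolding connected_graph_def by blast
  moreover from this obtain e where "e \<in> edges G" "ends G e = {x, y}"
    by (auto simp: adjacent_def)
  ultimately show ?thesis using that multigraph_ends_subset[OF assms(2)] by blast
qed

lemma connected_graph_grow_induct [consumes 4, case_names verts insert]:
  assumes "finite_multigraph G" "connected_graph G" "S \<subseteq> verts G" "S \<noteq> {}"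
    and "P (verts G)"
    and "\<And>S e x y. S \<subseteq> verts G \<Longrightarrow> x \<in> S \<Longrightarrow> y \<in> verts G - S \<Longrightarrow> e \<in> edges G \<Longrightarrow>
      ends G e = {x, y} \<Longrightarrow> P (insert y S) \<Longrightarrow> P S"
  shows "P S"
  using assms(3,4)
proof (induction "card (verts G - S)" arbitrary: S rule: less_induct)
  case less
  note fin = finite_multigraphD[OF assms(1)]
  show ?case
  proof (cases "S = verts G")
    case False
    then have "S \<subset> verts G" using less.prems by blast
    then obtain e x y where e: "e \<in> edges G" "ends G e = {x, y}" "x \<in> S" "y \<in> verts G - S"
      using connected_graph_crossing_edge[OF assms(2) fin(1)] less.prems by metis
    have "card (verts G - insert y S) < card (verts G - S)"
      using e fin by (intro psubset_card_mono) auto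
    then have "P (insert y S)" using less.prems e by (intro less.hyps) auto
    then show ?thesis using assms(6) less.prems e by blast
  qed (use assms(5) in simp)
qed

lemma connected_graph_card_verts_le:
  assumes "finite_multigraph G" "connected_graph G" "S \<subseteq> verts G" "S \<noteq> {}"
  shows "card (verts G) \<le> card S + card (edges G - induced_edges G S)"
  using assms
proof (induction rule: connected_graph_grow_induct)
  case (insert S e x y)
  note fin = finite_multigraphD[OF assms(1)]
  have "card (insert y S) = Suc (card S)"
    using insert.hyps fin by (simp add: finite_subset)
  moreover have "card (edges G - induced_edges G (insert y S)) < card (edges G - induced_edges G S)"
    using insert.hyps fin by (intro psubset_card_mono) (auto simp: induced_edges_def)
  ultimately show ?case using insert.IH by linarith
qed simp

lemma connected_graph_card_verts_le_Suc:
  assumes "finite_multigraph G" "connected_graph G"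
  shows "card (verts G) \<le> Suc (card (edges G))"
proof -
  obtain r where "r \<in> verts G" using assms(2) by (auto simp: connected_graph_def)
  then have "card (verts G) \<le> card {r} + card (edges G - induced_edges G {r})"
    using assms by (intro connected_graph_card_verts_le) auto
  also have "\<dots> \<le> Suc (card (edges G))"
    using finite_multigraphD[OF assms(1)] by (simp add: card_mono)
  finally show ?thesis .
qed

lemma edges_reaching_set:
  assumes "finite_multigraph G" "connected_graph G" "S \<subseteq> verts G" "S \<noteq> {}"
  shows "\<exists>A\<subseteq>edges G. card A \<le> card (verts G - S) \<and>
    (\<forall>v\<in>verts G. \<exists>s\<in>S. (adjacent (G\<lparr>edges := A\<rparr>))\<^sup>*\<^sup>* v s)"
  using assms
proof (induction rule: connected_graph_grow_induct)
  case verts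
  show ?case by (intro exI[of _ "{}"]) auto
next
  case (insert S e x y)
  obtain A where A: "A \<subseteq> edges G" "card A \<le> card (verts G - insert y S)"
    and reach: "\<And>v. v \<in> verts G \<Longrightarrow> \<exists>s\<in>insert y S. (adjacent (G\<lparr>edges := A\<rparr>))\<^sup>*\<^sup>* v s"
    using insert.IH by blast
  let ?H = "G\<lparr>edges := insert e A\<rparr>"
  have "adjacent ?H y x" using insert.hyps by (auto simp: adjacent_def)
  moreover have "(adjacent ?H)\<^sup>*\<^sup>* v s" if "(adjacent (G\<lparr>edges := A\<rparr>))\<^sup>*\<^sup>* v s" for v s
    using that by (rule reachable_mono) (auto intro: reachable_ends)
  ultimately have "\<exists>s\<in>S. (adjacent ?H)\<^sup>*\<^sup>* v s" if "v \<in> verts G" for v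
    using reach[OF that] insert.hyps by (metis insert_iff rtranclp.rtrancl_into_rtrancl)
  moreover have "card (verts G - insert y S) < card (verts G - S)"
    using insert.hyps finite_multigraphD[OF assms(1)] by (intro psubset_card_mono) auto
  then have "card (insert e A) \<le> card (verts G - S)"
    using A(2) card_insert_le_m1[of "card (verts G - S)" A e] by linarith
  ultimately show ?case using A(1) insert.hyps by (intro exI[of _ "insert e A"]) auto
qed

lemma connected_spanning_subgraph:
  assumes "finite_multigraph G" "connected_graph G"
  obtains A where "A \<subseteq> edges G" "connected_graph (G\<lparr>edges := A\<rparr>)" "Suc (card A) \<le> card (verts G)"
proof -
  note fin = finite_multigraphD[OF assms(1)]
  obtain r where r: "r \<in> verts G" using assms(2) by (auto simp: connected_graph_def)
  then obtain A where A: "A \<subseteq> edges G" "card A \<le> card (verts G - {r})"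
    "\<And>v. v \<in> verts G \<Longrightarrow> (adjacent (G\<lparr>edges := A\<rparr>))\<^sup>*\<^sup>* v r"
    using edges_reaching_set[OF assms, of "{r}"] by auto
  have "connected_graph (G\<lparr>edges := A\<rparr>)"
    by (rule connected_graph_from_root[of r]) (use r A(3) in auto)
  moreover have "Suc (card A) \<le> card (verts G)"
    using A(2) card_Suc_Diff1[OF fin(2) r] by linarith
  ultimately show ?thesis using A(1) that by blast
qed

section \<open>Cycles\<close>

definition path_in :: "('v, 'e) mgraph \<Rightarrow> 'v list \<Rightarrow> 'e list \<Rightarrow> bool" where
  "path_in G vs es \<longleftrightarrow>
     distinct vs \<and> length vs = Suc (length es) \<and> set es \<subseteq> edges G \<and>
     (\<forall>i<length es. ends G (es ! i) = {vs ! i, vs ! Suc i})"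

lemma path_in_distinct_edges:
  assumes "path_in G vs es"
  shows "distinct es"
proof (unfold distinct_conv_nth, intro allI impI notI)
  fix i j assume ij: "i < length es" "j < length es" "i \<noteq> j" "es ! i = es ! j"
  then have "{vs ! i, vs ! Suc i} = {vs ! j, vs ! Suc j}"
    using assms unfolding path_in_def by metis
  then have "i = j \<and> Suc i = Suc j \<or> i = Suc j \<and> Suc i = j"
    using ij assms by (auto simp: path_in_def doubleton_eq_iff nth_eq_iff_index_eq)
  then show False using ij by auto
qed

lemma path_in_take:
  assumes "path_in G vs es" "k \<le> length es"
  shows "path_in G (take (Suc k) vs) (take k es)"
  using assms set_take_subset[of k es] by (auto simp: path_in_def)

lemma path_in_snoc:
  assumes "path_in G vs es" "e \<in> edges G" "ends G e = {last vs, z}" "z \<notin> set vs"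
  shows "path_in G (vs @ [z]) (es @ [e])"
proof -
  have "vs \<noteq> []" using assms(1) by (auto simp: path_in_def)
  then have "last vs = vs ! length es"
    using assms(1) by (simp add: path_in_def last_conv_nth)
  then show ?thesis using assms by (auto simp: path_in_def nth_append less_Suc_eq)
qed

lemma reachable_path_in:
  assumes "(adjacent G)\<^sup>*\<^sup>* u v"
  obtains vs es where "path_in G vs es" "hd vs = u" "last vs = v"
proof -
  have "\<exists>vs es. path_in G vs es \<and> hd vs = u \<and> last vs = v"
    using assms
  proof (induction rule: rtranclp_induct)
    case base
    show ?case by (rule exI[of _ "[u]"], rule exI[of _ "[]"]) (simp add: path_in_def)
  next
    case (step y z)
    then obtain vs es where path: "path_in G vs es" "hd vs = u" "last vs = y" by blast
    obtain e where e: "e \<in> edges G" "ends G e = {y, z}"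
      using step.hyps by (auto simp: adjacent_def)
    have len: "length vs = Suc (length es)" using path(1) by (simp add: path_in_def)
    then have "vs \<noteq> []" by auto
    show ?case
    proof (cases "z \<in> set vs")
      case True
      then obtain k where k: "k < length vs" "vs ! k = z" by (auto simp: in_set_conv_nth)
      then have "path_in G (take (Suc k) vs) (take k es)"
        using path(1) len by (intro path_in_take) auto
      moreover have "hd (take (Suc k) vs) = u" using path(2) by simp
      moreover have "last (take (Suc k) vs) = z" using k by (simp add: take_Suc_conv_app_nth)
      ultimately show ?thesis by blast
    next
      case False
      then have "path_in G (vs @ [z]) (es @ [e])" using path e by (intro path_in_snoc) auto
      moreover have "hd (vs @ [z]) = u" "last (vs @ [z]) = z" using path(2) \<open>vs \<noteq> []\<close> by auto
      ultimately show ?thesis by blast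
    qed
  qed
  then show ?thesis using that by blast
qed

lemma cycle_in_close_path:
  assumes "multigraph G" "path_in G vs es" "e \<in> edges G - set es" "ends G e = {last vs, hd vs}"
  shows "cycle_in G (insert e (set es))"
proof -
  have len: "length vs = Suc (length es)" using assms(2) by (simp add: path_in_def)
  then have ne: "vs \<noteq> []" by auto
  have ends: "ends G ((es @ [e]) ! i) = {vs ! i, vs ! (Suc i mod length vs)}"
    if "i < length vs" for i
  proof (cases "i < length es")
    case True
    then show ?thesis using assms(2) len by (simp add: path_in_def nth_append)
  next
    case False
    then have "i = length es" using that len by simp
    then show ?thesis using assms(4) len ne by (simp add: hd_conv_nth last_conv_nth)
  qed
  have edges: "set (es @ [e]) \<subseteq> edges G" using assms(2,3) by (auto simp: path_in_def)
  have "set vs \<subseteq> verts G"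
  proof
    fix x assume "x \<in> set vs"
    then obtain i where i: "i < length vs" "x = vs ! i" by (auto simp: in_set_conv_nth)
    then have "(es @ [e]) ! i \<in> edges G" using edges len nth_mem[of i "es @ [e]"] by auto
    moreover have "x \<in> ends G ((es @ [e]) ! i)" using ends i by simp
    ultimately show "x \<in> verts G" using multigraph_ends_subset[OF assms(1)] by blast
  qed
  moreover have "distinct vs" "distinct (es @ [e])" "insert e (set es) = set (es @ [e])"
    using assms(2,3) path_in_distinct_edges[OF assms(2)] by (auto simp: path_in_def)
  moreover have "length (es @ [e]) = length vs" using len by simp
  ultimately show ?thesis using ne ends edges unfolding cycle_in_def by blast
qed

lemma cycle_in_edge_on_cycle:
  assumes "multigraph G" "e \<in> edges G" "ends G e = {u, v}" "(adjacent (delete_edge G e))\<^sup>*\<^sup>* u v"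
  obtains C where "cycle_in G C"
proof -
  obtain vs es where path: "path_in (delete_edge G e) vs es" "hd vs = u" "last vs = v"
    using reachable_path_in[OF assms(4)] by blast
  then have "path_in G vs es" "e \<notin> set es" by (auto simp: path_in_def)
  then have "cycle_in G (insert e (set es))"
    using assms path by (intro cycle_in_close_path) (auto simp: insert_commute)
  then show ?thesis using that by blast
qed

lemma cycle_in_delete_edge_iff: "cycle_in (delete_edge G e) C \<longleftrightarrow> cycle_in G C \<and> e \<notin> C"
  unfolding cycle_in_def delete_edge_simps by blast

lemma cycle_in_subset: "cycle_in G C \<Longrightarrow> C \<subseteq> edges G"
  by (auto simp: cycle_in_def)

lemma cycle_in_nonempty: "cycle_in G C \<Longrightarrow> C \<noteq> {}"
  by (auto simp: cycle_in_def)

lemma cycle_edge_ends_reachable: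
  assumes "cycle_in G C" "f \<in> C" "ends G f = {x, y}"
  shows "(adjacent (delete_edge G f))\<^sup>*\<^sup>* x y"
proof -
  obtain vs es where cycle: "vs \<noteq> []" "length es = length vs" "distinct es" "set es \<subseteq> edges G"
    "\<And>i. i < length vs \<Longrightarrow> ends G (es ! i) = {vs ! i, vs ! (Suc i mod length vs)}" "C = set es"
    using assms(1) unfolding cycle_in_def by blast
  define n where "n = length vs"
  define w where "w i = vs ! (i mod n)" for i
  have n: "n > 0" using cycle(1) by (simp add: n_def)
  obtain k where k: "k < n" "f = es ! k" using assms(2) cycle by (auto simp: in_set_conv_nth n_def)
  have step: "adjacent (delete_edge G f) (w i) (w (Suc i))" if i: "k < i" "i < k + n" for i
  proof -
    have "i mod n \<noteq> k"
    proof
      assume "i mod n = k"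
      then have "i mod n = k mod n" using k(1) by simp
      then have "n dvd i - k" using i by (simp add: mod_eq_dvd_iff_nat)
      then show False using i by (auto dest: dvd_imp_le)
    qed
    then have "es ! (i mod n) \<in> edges G - {f}"
      using cycle n k by (auto simp: n_def nth_eq_iff_index_eq)
    moreover have "ends G (es ! (i mod n)) = {w i, w (Suc i)}"
      using cycle(5)[of "i mod n"] n by (simp add: w_def n_def mod_Suc_eq)
    ultimately show ?thesis by (auto simp: adjacent_def)
  qed
  have "Suc k \<le> k + n" using n by simp
  then have "(adjacent (delete_edge G f))\<^sup>*\<^sup>* (w (Suc k)) (w (k + n))"
    by (induction rule: dec_induct) (use step in \<open>auto intro: rtranclp.rtrancl_into_rtrancl\<close>)
  then have "(adjacent (delete_edge G f))\<^sup>*\<^sup>* (w (Suc k)) (w k)" by (simp add: w_def)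
  moreover have "{x, y} = {w k, w (Suc k)}"
    using assms(3) cycle(5)[of k] k by (simp add: w_def n_def)
  ultimately show ?thesis
    using reachable_commute[of "delete_edge G f"] by (auto simp: doubleton_eq_iff)
qed

lemma connected_graph_delete_cycle_edge:
  assumes "connected_graph G" "cycle_in G C" "f \<in> C"
  shows "connected_graph (delete_edge G f)"
proof (rule connected_graph_mono[OF assms(1)])
  fix e x y assume e: "e \<in> edges G" "ends G e = {x, y}"
  show "(adjacent (delete_edge G f))\<^sup>*\<^sup>* x y"
  proof (cases "e = f")
    case True
    then show ?thesis using cycle_edge_ends_reachable assms(2,3) e(2) by metis
  next
    case False
    then show ?thesis using e by (auto intro: reachable_ends)
  qed
qed simp

section \<open>Trees and unicyclic graphs\<close>

lemma tree_spanning_edges_eq: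
  assumes "multigraph T" "tree T" "A \<subseteq> edges T" "connected_graph (T\<lparr>edges := A\<rparr>)"
  shows "A = edges T"
proof (rule ccontr)
  assume "A \<noteq> edges T"
  then obtain e where e: "e \<in> edges T" "e \<notin> A" using assms(3) by blast
  obtain u v where uv: "u \<in> verts T" "v \<in> verts T" "ends T e = {u, v}"
    using multigraph_ends[OF assms(1) e(1)] .
  have "(adjacent (T\<lparr>edges := A\<rparr>))\<^sup>*\<^sup>* u v" using assms(4) uv by (simp add: connected_graph_def)
  then have "(adjacent (delete_edge T e))\<^sup>*\<^sup>* u v"
    by (rule reachable_mono) (rule reachable_ends, use assms(3) e(2) in auto)
  then obtain C where "cycle_in T C" using cycle_in_edge_on_cycle[OF assms(1) e(1) uv(3)] by blast
  then show False using assms(2) by (auto simp: tree_def)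
qed

lemma tree_iff_card:
  assumes "finite_multigraph T"
  shows "tree T \<longleftrightarrow> connected_graph T \<and> Suc (card (edges T)) = card (verts T)"
proof
  assume tree: "tree T"
  then have con: "connected_graph T" by (simp add: tree_def)
  obtain A where "A \<subseteq> edges T" "connected_graph (T\<lparr>edges := A\<rparr>)" "Suc (card A) \<le> card (verts T)"
    using connected_spanning_subgraph[OF assms con] .
  then have "Suc (card (edges T)) \<le> card (verts T)"
    using tree_spanning_edges_eq[OF finite_multigraphD(1)[OF assms] tree] by blast
  then show "connected_graph T \<and> Suc (card (edges T)) = card (verts T)"
    using con connected_graph_card_verts_le_Suc[OF assms con] by simp
next
  assume T: "connected_graph T \<and> Suc (card (edges T)) = card (verts T)"
  have False if C: "cycle_in T C" for C
  proof -
    obtain f where f: "f \<in> C" "f \<in> edges T"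
      using cycle_in_nonempty[OF C] cycle_in_subset[OF C] by blast
    have "card (verts T) \<le> Suc (card (edges (delete_edge T f)))"
      using connected_graph_card_verts_le_Suc[OF finite_multigraph_delete_edge[OF assms, of f]]
        connected_graph_delete_cycle_edge[OF _ C f(1)] T by simp
    then show False using T card_edges_delete_edge[OF assms f(2)] by linarith
  qed
  then show "tree T" using T by (auto simp: tree_def)
qed

lemma tree_delete_cycle_edge:
  assumes "finite_multigraph M" "connected_graph M" "card (edges M) = card (verts M)"
    and "cycle_in M C" "e \<in> C"
  shows "tree (delete_edge M e)"
proof -
  have "e \<in> edges M" using assms(4,5) cycle_in_subset by blast
  then have "Suc (card (edges (delete_edge M e))) = card (verts (delete_edge M e))"
    using card_edges_delete_edge[OF assms(1)] assms(3) by simp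
  then show ?thesis
    using connected_graph_delete_cycle_edge[OF assms(2,4,5)]
    by (simp add: tree_iff_card finite_multigraph_delete_edge assms(1) del: delete_edge_simps)
qed

lemma cycle_in_if_card_edges:
  assumes "finite_multigraph M" "connected_graph M" "card (edges M) = card (verts M)"
  obtains C where "cycle_in M C"
proof -
  have "\<not> tree M" using tree_iff_card[OF assms(1)] assms(3) by simp
  then show ?thesis using assms(2) that by (auto simp: tree_def)
qed

lemma connected_graph_unicyclic_iff_card:
  assumes "finite_multigraph M" "connected_graph M"
  shows "(\<exists>!C. cycle_in M C) \<longleftrightarrow> card (edges M) = card (verts M)"
proof
  assume "\<exists>!C. cycle_in M C"
  then obtain C where C: "cycle_in M C" and unique: "\<And>D. cycle_in M D \<Longrightarrow> D = C" by blast
  obtain e where e: "e \<in> C" "e \<in> edges M"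
    using cycle_in_nonempty[OF C] cycle_in_subset[OF C] by blast
  have "tree (delete_edge M e)"
    using connected_graph_delete_cycle_edge[OF assms(2) C e(1)] unique e(1)
    by (auto simp: tree_def cycle_in_delete_edge_iff)
  then show "card (edges M) = card (verts M)"
    using tree_iff_card[OF finite_multigraph_delete_edge[OF assms(1)]]
      card_edges_delete_edge[OF assms(1) e(2)] by simp
next
  assume card: "card (edges M) = card (verts M)"
  have subset: "C \<subseteq> D" if C: "cycle_in M C" and D: "cycle_in M D" for C D
  proof (rule subsetI, rule ccontr)
    fix f assume f: "f \<in> C" "f \<notin> D"
    then have "tree (delete_edge M f)" "cycle_in (delete_edge M f) D"
      using tree_delete_cycle_edge[OF assms card C] D by (auto simp: cycle_in_delete_edge_iff)
    then show False by (auto simp: tree_def)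
  qed
  obtain C where "cycle_in M C" using cycle_in_if_card_edges[OF assms card] .
  then show "\<exists>!C. cycle_in M C" using subset by blast
qed

lemma connected_graph_card_iff_tree_delete_edge:
  assumes "finite_multigraph M"
  shows "connected_graph M \<and> card (edges M) = card (verts M) \<longleftrightarrow>
    (\<exists>e\<in>edges M. tree (delete_edge M e))"
proof
  assume M: "connected_graph M \<and> card (edges M) = card (verts M)"
  then obtain C where C: "cycle_in M C" using cycle_in_if_card_edges[OF assms] by blast
  obtain e where e: "e \<in> C" "e \<in> edges M"
    using cycle_in_nonempty[OF C] cycle_in_subset[OF C] by blast
  then show "\<exists>e\<in>edges M. tree (delete_edge M e)"
    using tree_delete_cycle_edge[OF assms _ _ C] M by blast
next
  assume "\<exists>e\<in>edges M. tree (delete_edge M e)"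
  then obtain e where e: "e \<in> edges M" "connected_graph (delete_edge M e)"
    "Suc (card (edges (delete_edge M e))) = card (verts M)"
    using tree_iff_card[OF finite_multigraph_delete_edge[OF assms]] by auto
  have "connected_graph M"
    by (rule connected_graph_mono[OF e(2)]) (auto intro: reachable_ends)
  then show "connected_graph M \<and> card (edges M) = card (verts M)"
    using e(3) card_edges_delete_edge[OF assms e(1)] by simp
qed

lemma component_of_connected_iff:
  assumes "connected_graph M" "multigraph M"
  shows "component_of H M \<longleftrightarrow> H = M"
  using assms by (auto simp: component_of_def subgraph_def)

theorem connected_map_graph_iff_tree_delete_edge:
  assumes "finite_multigraph M"
  shows "connected_graph M \<and> map_graph M \<longleftrightarrow> (\<exists>e\<in>edges M. tree (delete_edge M e))"
proof -
  have "map_graph M \<longleftrightarrow> card (edges M) = card (verts M)" if "connected_graph M"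
    using component_of_connected_iff[OF that finite_multigraphD(1)[OF assms]]
      connected_graph_unicyclic_iff_card[OF assms that] by (simp add: map_graph_def)
  then show ?thesis using connected_graph_card_iff_tree_delete_edge[OF assms] by blast
qed

section \<open>Two spanning trees and an edge\<close>

definition two_trees_plus_edge :: "('v, 'e) mgraph \<Rightarrow> bool" where
  "two_trees_plus_edge G \<longleftrightarrow>
     (\<exists>A B e. A \<inter> B = {} \<and> e \<notin> A \<union> B \<and> edges G = insert e (A \<union> B) \<and>
        tree (G\<lparr>edges := A\<rparr>) \<and> tree (G\<lparr>edges := B\<rparr>))"

lemma two_trees_plus_edgeI:
  assumes "A \<inter> B = {}" "e \<notin> A \<union> B" "edges G = insert e (A \<union> B)"
    and "tree (G\<lparr>edges := A\<rparr>)" "tree (G\<lparr>edges := B\<rparr>)"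
  shows "two_trees_plus_edge G"
  using assms unfolding two_trees_plus_edge_def by blast

lemma two_trees_plus_edgeE:
  assumes "two_trees_plus_edge G"
  obtains A B e where "A \<inter> B = {}" "e \<notin> A \<union> B" "edges G = insert e (A \<union> B)"
    "tree (G\<lparr>edges := A\<rparr>)" "tree (G\<lparr>edges := B\<rparr>)"
  using assms unfolding two_trees_plus_edge_def by blast

lemma spanning_subgraph_iff_edges_update:
  assumes "multigraph G"
  shows "spanning_subgraph H G \<longleftrightarrow> (\<exists>A\<subseteq>edges G. H = G\<lparr>edges := A\<rparr>)"
proof
  assume "spanning_subgraph H G"
  then have "edges H \<subseteq> edges G" "H = G\<lparr>edges := edges H\<rparr>"
    by (auto simp: spanning_subgraph_def subgraph_def)
  then show "\<exists>A\<subseteq>edges G. H = G\<lparr>edges := A\<rparr>" by blast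
next
  assume "\<exists>A\<subseteq>edges G. H = G\<lparr>edges := A\<rparr>"
  then show "spanning_subgraph H G"
    using assms by (auto simp: spanning_subgraph_def subgraph_def multigraph_def)
qed

lemma tree_map_decomposable_iff:
  assumes "finite_multigraph G"
  shows "tree_map_decomposable G \<longleftrightarrow>
    (\<exists>A D. A \<union> D = edges G \<and> A \<inter> D = {} \<and> tree (G\<lparr>edges := A\<rparr>) \<and>
       (\<exists>e\<in>D. tree (G\<lparr>edges := D - {e}\<rparr>)))"
proof -
  have map_iff: "connected_graph (G\<lparr>edges := D\<rparr>) \<and> map_graph (G\<lparr>edges := D\<rparr>) \<longleftrightarrow>
    (\<exists>e\<in>D. tree (G\<lparr>edges := D - {e}\<rparr>))" if "D \<subseteq> edges G" for D
    using connected_map_graph_iff_tree_delete_edge[OF finite_multigraph_edges_update[OF assms that]]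
    by (simp add: delete_edge_def)
  note spanning = spanning_subgraph_iff_edges_update[OF finite_multigraphD(1)[OF assms]]
  show ?thesis (is "_ \<longleftrightarrow> ?R")
  proof
    assume "tree_map_decomposable G"
    then obtain T M where decomposition: "spanning_subgraph T G" "tree T" "spanning_subgraph M G"
      "connected_graph M" "map_graph M" "edges T \<inter> edges M = {}" "edges T \<union> edges M = edges G"
      by (auto simp: tree_map_decomposable_def)
    obtain A where A: "T = G\<lparr>edges := A\<rparr>" using decomposition(1) spanning by metis
    obtain D where D: "D \<subseteq> edges G" "M = G\<lparr>edges := D\<rparr>" using decomposition(3) spanning by metis
    have "A \<union> D = edges G" "A \<inter> D = {}" "tree (G\<lparr>edges := A\<rparr>)"
      "\<exists>e\<in>D. tree (G\<lparr>edges := D - {e}\<rparr>)"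
      using decomposition(2,4-7) map_iff[OF D(1)] A D(2) by simp_all
    then show ?R by blast
  next
    assume ?R
    then obtain A D where partition: "A \<union> D = edges G" "A \<inter> D = {}" "tree (G\<lparr>edges := A\<rparr>)"
      and "\<exists>e\<in>D. tree (G\<lparr>edges := D - {e}\<rparr>)" by blast
    then have "connected_graph (G\<lparr>edges := D\<rparr>)" "map_graph (G\<lparr>edges := D\<rparr>)"
      using map_iff[of D] by auto
    moreover have "spanning_subgraph (G\<lparr>edges := C\<rparr>) G" if "C \<subseteq> edges G" for C
      using that spanning by metis
    ultimately show "tree_map_decomposable G"
      unfolding tree_map_decomposable_def using partition
      by - (rule exI[of _ "G\<lparr>edges := A\<rparr>"], rule exI[of _ "G\<lparr>edges := D\<rparr>"], auto)
  qed
qed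

lemma tree_map_decomposable_iff_two_trees_plus_edge:
  assumes "finite_multigraph G"
  shows "tree_map_decomposable G \<longleftrightarrow> two_trees_plus_edge G"
proof
  assume "tree_map_decomposable G"
  then obtain A D e where "A \<union> D = edges G" "A \<inter> D = {}" "e \<in> D"
    "tree (G\<lparr>edges := A\<rparr>)" "tree (G\<lparr>edges := D - {e}\<rparr>)"
    using tree_map_decomposable_iff[OF assms] by blast
  then show "two_trees_plus_edge G"
    by (intro two_trees_plus_edgeI[of A "D - {e}" e]) auto
next
  assume "two_trees_plus_edge G"
  then obtain A B e where dec: "A \<inter> B = {}" "e \<notin> A \<union> B" "edges G = insert e (A \<union> B)"
    "tree (G\<lparr>edges := A\<rparr>)" "tree (G\<lparr>edges := B\<rparr>)"
    by (rule two_trees_plus_edgeE)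
  have "A \<union> insert e B = edges G" "A \<inter> insert e B = {}" "insert e B - {e} = B" using dec by auto
  then show "tree_map_decomposable G"
    using dec(4,5) tree_map_decomposable_iff[OF assms] by (metis insertI1)
qed

section \<open>Vertex extensions and the moves\<close>

definition vertex_extension ::
    "('v, 'e) mgraph \<Rightarrow> 'v \<Rightarrow> 'e set \<Rightarrow> ('v, 'e) mgraph \<Rightarrow> bool" where
  "vertex_extension G v F G' \<longleftrightarrow>
     v \<notin> verts G \<and> F \<inter> edges G = {} \<and>
     verts G' = insert v (verts G) \<and> edges G' = edges G \<union> F \<and>
     (\<forall>e\<in>edges G. ends G' e = ends G e) \<and> (\<forall>f\<in>F. \<exists>x\<in>verts G. ends G' f = {v, x})"

definition edge_split ::
    "('v, 'e) mgraph \<Rightarrow> 'e \<Rightarrow> 'v \<Rightarrow> 'e set \<Rightarrow> ('v, 'e) mgraph \<Rightarrow> bool" where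
  "edge_split G d v F G' \<longleftrightarrow>
     d \<in> edges G \<and> vertex_extension (delete_edge G d) v F G' \<and>
     (\<exists>x y. x \<noteq> y \<and> ends G d = {x, y} \<and> {{v, x}, {v, y}} \<subseteq> ends G' ` F)"

lemma finite_multigraph_vertex_extension:
  assumes "finite_multigraph G" "finite F" "vertex_extension G v F G'"
  shows "finite_multigraph G'"
proof -
  have "\<exists>x\<in>verts G'. \<exists>y\<in>verts G'. ends G' e = {x, y}" if "e \<in> edges G'" for e
  proof -
    consider (old) "e \<in> edges G" | (new) "e \<in> F"
      using \<open>e \<in> edges G'\<close> assms(3) by (auto simp: vertex_extension_def)
    then show ?thesis
    proof cases
      case old
      then obtain p q where "p \<in> verts G" "q \<in> verts G" "ends G e = {p, q}"
        using multigraph_ends finite_multigraphD(1)[OF assms(1)] by metis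
      then have "p \<in> verts G'" "q \<in> verts G'" "ends G' e = {p, q}"
        using old assms(3) by (auto simp: vertex_extension_def)
      then show ?thesis by blast
    next
      case new
      then show ?thesis using assms(3) unfolding vertex_extension_def by (metis insertCI)
    qed
  qed
  then show ?thesis
    using assms by (auto simp: finite_multigraph_def multigraph_def vertex_extension_def)
qed

lemma vertex_extension_edges_update:
  assumes "vertex_extension G v F G'" "A \<subseteq> edges G" "D \<subseteq> F"
  shows "vertex_extension (G\<lparr>edges := A\<rparr>) v D (G'\<lparr>edges := A \<union> D\<rparr>)"
  using assms by (auto simp: vertex_extension_def)

lemma move_1_iff_vertex_extension:
  "move_1a G G' \<or> move_1b G G' \<longleftrightarrow> (\<exists>v F. vertex_extension G v F G' \<and> card F = 2)"
proof
  assume "move_1a G G' \<or> move_1b G G'"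
  then obtain v x y f1 f2 where "v \<notin> verts G" "x \<in> verts G" "y \<in> verts G" "f1 \<noteq> f2"
    "{f1, f2} \<inter> edges G = {}" "verts G' = insert v (verts G)" "edges G' = edges G \<union> {f1, f2}"
    "\<forall>f\<in>edges G. ends G' f = ends G f" "ends G' f1 = {v, x}" "ends G' f2 = {v, y}"
    unfolding move_1a_def move_1b_def distinct_length_2_or_more by blast
  then have "vertex_extension G v {f1, f2} G'" "card {f1, f2} = 2"
    by (auto simp: vertex_extension_def)
  then show "\<exists>v F. vertex_extension G v F G' \<and> card F = 2" by blast
next
  assume "\<exists>v F. vertex_extension G v F G' \<and> card F = 2"
  then obtain v f1 f2 where ext: "vertex_extension G v {f1, f2} G'" and f: "f1 \<noteq> f2"
    by (auto simp: card_2_iff)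
  obtain x y where xy: "x \<in> verts G" "y \<in> verts G" "ends G' f1 = {v, x}" "ends G' f2 = {v, y}"
    using ext by (auto simp: vertex_extension_def)
  show "move_1a G G' \<or> move_1b G G'"
  proof (cases "x = y")
    case True
    have "move_1b G G'" unfolding move_1b_def
      by (rule exI[of _ v], rule exI[of _ x], rule exI[of _ f1], rule exI[of _ f2])
        (use ext f xy True in \<open>simp add: vertex_extension_def\<close>)
    then show ?thesis ..
  next
    case False
    have "move_1a G G'" unfolding move_1a_def
      by (rule exI[of _ v], rule exI[of _ x], rule exI[of _ y],
          rule exI[of _ f1], rule exI[of _ f2])
        (use ext f xy False in \<open>simp add: vertex_extension_def\<close>)
    then show ?thesis ..
  qed
qed

lemma edge_split_if_move_2:
  assumes "move_2a G G' \<or> move_2b G G'"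
  shows "\<exists>d v F. edge_split G d v F G' \<and> card F = 3"
proof -
  obtain v x y z d f1 f2 f3 where config: "v \<notin> verts G" "{x, y, z} \<subseteq> verts G" "x \<noteq> y" "d \<in> edges G"
    "ends G d = {x, y}" "distinct [f1, f2, f3]" "{f1, f2, f3} \<inter> (edges G - {d}) = {}"
    "verts G' = insert v (verts G)" "edges G' = (edges G - {d}) \<union> {f1, f2, f3}"
    "\<forall>f\<in>edges G - {d}. ends G' f = ends G f"
    "ends G' f1 = {v, x}" "ends G' f2 = {v, y}" "ends G' f3 = {v, z}"
    using assms
  proof
    assume "move_2a G G'"
    then show ?thesis unfolding move_2a_def by (elim exE conjE) (rule that; (assumption | simp))
  next
    assume "move_2b G G'"
    then show ?thesis unfolding move_2b_def by (elim exE conjE) (rule that; (assumption | simp))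
  qed
  then have "edge_split G d v {f1, f2, f3} G'"
    by (auto simp: edge_split_def vertex_extension_def)
  moreover have "card {f1, f2, f3} = 3" using config(6) by simp
  ultimately show ?thesis by blast
qed

lemma edge_split_edges:
  assumes "edge_split G d v F G'" "card F = 3"
  obtains f1 f2 f3 x y z where "F = {f1, f2, f3}" "distinct [f1, f2, f3]" "x \<noteq> y"
    "z \<noteq> x" "ends G d = {x, y}" "{x, y, z} \<subseteq> verts G"
    "ends G' f1 = {v, x}" "ends G' f2 = {v, y}" "ends G' f3 = {v, z}"
proof -
  obtain x y f1 f2 where xy: "x \<noteq> y" "ends G d = {x, y}"
    and f: "f1 \<in> F" "f2 \<in> F" "ends G' f1 = {v, x}" "ends G' f2 = {v, y}"
    using assms(1) unfolding edge_split_def by fastforce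
  have ext: "vertex_extension (delete_edge G d) v F G'" using assms(1) by (simp add: edge_split_def)
  have "f1 \<noteq> f2" using xy(1) f(3,4) by (auto simp: doubleton_eq_iff)
  moreover have "finite F" using assms(2) by (simp add: card_ge_0_finite)
  ultimately have "card (F - {f1, f2}) = 1" using assms(2) f by (simp add: card_Diff_subset)
  then obtain f3 where "F - {f1, f2} = {f3}" by (auto simp: card_1_singleton_iff)
  then have F: "F = {f1, f2, f3}" "distinct [f1, f2, f3]" using f \<open>f1 \<noteq> f2\<close> by auto
  then obtain z where z: "z \<in> verts G" "ends G' f3 = {v, z}"
    using ext by (auto simp: vertex_extension_def)
  have "x \<in> verts G" "y \<in> verts G"
    using ext f by (auto simp: vertex_extension_def doubleton_eq_iff)
  then show ?thesis
    using that[of f1 f2 f3 x y z] that[of f2 f1 f3 y x z] F xy f z by (auto simp: insert_commute)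
qed

lemma move_2_if_edge_split:
  assumes "edge_split G d v F G'" "card F = 3"
  shows "move_2a G G' \<or> move_2b G G'"
proof -
  obtain f1 f2 f3 x y z where F: "F = {f1, f2, f3}" "distinct [f1, f2, f3]" "x \<noteq> y" "z \<noteq> x"
    "ends G d = {x, y}" "{x, y, z} \<subseteq> verts G"
    "ends G' f1 = {v, x}" "ends G' f2 = {v, y}" "ends G' f3 = {v, z}"
    using edge_split_edges[OF assms] .
  have G': "d \<in> edges G" "v \<notin> verts G" "F \<inter> (edges G - {d}) = {}" "verts G' = insert v (verts G)"
    "edges G' = (edges G - {d}) \<union> F" "\<forall>f\<in>edges G - {d}. ends G' f = ends G f"
    using assms(1) by (auto simp: edge_split_def vertex_extension_def)
  show ?thesis
  proof (cases "z = y")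
    case True
    have "move_2b G G'" unfolding move_2b_def
      by (rule exI[of _ v], rule exI[of _ x], rule exI[of _ y], rule exI[of _ d],
          rule exI[of _ f1], rule exI[of _ f2], rule exI[of _ f3])
        (use True F G' in auto)
    then show ?thesis ..
  next
    case False
    have "move_2a G G'" unfolding move_2a_def
      by (rule exI[of _ v], rule exI[of _ x], rule exI[of _ y], rule exI[of _ z],
          rule exI[of _ d], rule exI[of _ f1], rule exI[of _ f2], rule exI[of _ f3])
        (use False F G' in auto)
    then show ?thesis ..
  qed
qed

lemma move_cases [consumes 1, case_names extension split]:
  assumes "move G G'"
  obtains v F where "vertex_extension G v F G'" "card F = 2"
  | d v F where "edge_split G d v F G'" "card F = 3"
  using assms move_1_iff_vertex_extension edge_split_if_move_2 unfolding move_def by metis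

lemma move_if_vertex_extension: "vertex_extension G v F G' \<Longrightarrow> card F = 2 \<Longrightarrow> move G G'"
  using move_1_iff_vertex_extension unfolding move_def by metis

lemma move_if_edge_split: "edge_split G d v F G' \<Longrightarrow> card F = 3 \<Longrightarrow> move G G'"
  using move_2_if_edge_split unfolding move_def by metis

lemma finite_multigraph_move:
  assumes "finite_multigraph G" "move G G'"
  shows "finite_multigraph G'"
  using assms(2)
proof (cases rule: move_cases)
  case (extension v F)
  then show ?thesis
    using finite_multigraph_vertex_extension[OF assms(1) _ extension(1)]
    by (simp add: card_ge_0_finite)
next
  case (split d v F)
  then show ?thesis
    using finite_multigraph_vertex_extension[OF finite_multigraph_delete_edge[OF assms(1), of d]]
    by (metis card_ge_0_finite edge_split_def zero_less_numeral)
qed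

lemma tree_add_leaf:
  assumes "finite_multigraph T" "tree T" "vertex_extension T v {f} T'"
  shows "tree T'"
proof -
  obtain x where T': "v \<notin> verts T" "f \<notin> edges T" "verts T' = insert v (verts T)"
    "edges T' = insert f (edges T)" "\<forall>e\<in>edges T. ends T' e = ends T e"
    "x \<in> verts T" "ends T' f = {v, x}"
    using assms(3) by (auto simp: vertex_extension_def)
  have T: "connected_graph T" "Suc (card (edges T)) = card (verts T)"
    using assms(1,2) tree_iff_card by auto
  have "connected_graph T'"
  proof (rule connected_graph_insert_vertex[OF T(1) T'(3,6)])
    show "adjacent T' v x" using T' by (auto simp: adjacent_def)
    show "(adjacent T')\<^sup>*\<^sup>* p q" if "e \<in> edges T" "ends T e = {p, q}" for e p q
      using that T' by (intro reachable_ends[of e]) auto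
  qed
  moreover have "Suc (card (edges T')) = card (verts T')"
    using T T' finite_multigraphD[OF assms(1)] by simp
  moreover have "finite_multigraph T'"
    using finite_multigraph_vertex_extension[OF assms(1) _ assms(3)] by simp
  ultimately show ?thesis using tree_iff_card by blast
qed

lemma connected_graph_subdivide_edge:
  assumes "multigraph G" "connected_graph G" "d \<in> edges G" "ends G d = {x, y}"
    and ext: "vertex_extension (delete_edge G d) v F G'"
    and new: "{{v, x}, {v, y}} \<subseteq> ends G' ` F"
  shows "connected_graph G'"
proof -
  have x: "x \<in> verts G" using multigraph_ends_subset[OF assms(1,3)] assms(4) by simp
  have verts: "verts G' = insert v (verts G)" using ext by (simp add: vertex_extension_def)
  have adj: "adjacent G' v x" "adjacent G' v y"
    using new ext by (auto simp: adjacent_def vertex_extension_def)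
  show ?thesis
  proof (rule connected_graph_insert_vertex[OF assms(2) verts x adj(1)])
    fix e p q assume e: "e \<in> edges G" "ends G e = {p, q}"
    show "(adjacent G')\<^sup>*\<^sup>* p q"
    proof (cases "e = d")
      case True
      have "(adjacent G')\<^sup>*\<^sup>* x y"
        using adj adjacent_commute[of G' v x]
        by (meson converse_rtranclp_into_rtranclp r_into_rtranclp)
      then show ?thesis
        using True e(2) assms(4) reachable_commute[of G'] by (auto simp: doubleton_eq_iff)
    next
      case False
      then show ?thesis
        using e ext by (intro reachable_ends[of e]) (auto simp: vertex_extension_def)
    qed
  qed
qed

lemma tree_subdivide_edge:
  assumes "finite_multigraph T" "tree T" "d \<in> edges T" "ends T d = {x, y}"
    and ext: "vertex_extension (delete_edge T d) v F T'" and "card F = 2"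
    and new: "{{v, x}, {v, y}} \<subseteq> ends T' ` F"
  shows "tree T'"
proof -
  note fin = finite_multigraphD[OF assms(1)]
  have T: "connected_graph T" "Suc (card (edges T)) = card (verts T)"
    using assms(1,2) tree_iff_card by auto
  have T': "v \<notin> verts T" "F \<inter> (edges T - {d}) = {}" "verts T' = insert v (verts T)"
    "edges T' = (edges T - {d}) \<union> F"
    using ext by (auto simp: vertex_extension_def)
  have finF: "finite F" using \<open>card F = 2\<close> by (simp add: card_ge_0_finite)
  have "card (edges T') = card (edges T - {d}) + card F"
    unfolding T'(4) using fin(3) finF T'(2) by (intro card_Un_disjoint) auto
  also have "\<dots> = Suc (card (edges T))" using \<open>card F = 2\<close> card.remove[OF fin(3) assms(3)] by simp
  finally have "Suc (card (edges T')) = card (verts T')" using T T' fin by simp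
  moreover have "connected_graph T'"
    by (rule connected_graph_subdivide_edge[OF fin(1) T(1) assms(3,4) ext new])
  moreover have "finite_multigraph T'"
    using finite_multigraph_delete_edge[OF assms(1)] finF ext
    by (rule finite_multigraph_vertex_extension)
  ultimately show ?thesis using tree_iff_card by blast
qed

lemma tree_edges_update_add_leaf:
  assumes "finite_multigraph G" "A \<subseteq> edges G" "tree (G\<lparr>edges := A\<rparr>)"
    and "vertex_extension G v F G'" "f \<in> F"
  shows "tree (G'\<lparr>edges := insert f A\<rparr>)"
  using tree_add_leaf[OF finite_multigraph_edges_update[OF assms(1,2)] assms(3)]
    vertex_extension_edges_update[OF assms(4,2), of "{f}"] assms(5) by auto

lemma tree_edges_update_subdivide_edge:
  assumes "finite_multigraph G" "A \<subseteq> edges G" "tree (G\<lparr>edges := A\<rparr>)"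
    and "d \<in> A" "ends G d = {x, y}" "vertex_extension (delete_edge G d) v F G'"
    and "f \<in> F" "f' \<in> F" "f \<noteq> f'" "ends G' f = {v, x}" "ends G' f' = {v, y}"
  shows "tree (G'\<lparr>edges := (A - {d}) \<union> {f, f'}\<rparr>)"
proof (rule tree_subdivide_edge[of "G\<lparr>edges := A\<rparr>" d x y v "{f, f'}"])
  show "finite_multigraph (G\<lparr>edges := A\<rparr>)" by (rule finite_multigraph_edges_update[OF assms(1,2)])
  have "vertex_extension ((delete_edge G d)\<lparr>edges := A - {d}\<rparr>) v {f, f'}
      (G'\<lparr>edges := (A - {d}) \<union> {f, f'}\<rparr>)"
    by (rule vertex_extension_edges_update[OF assms(6)]) (use assms(2,7,8) in auto)
  then show "vertex_extension (delete_edge (G\<lparr>edges := A\<rparr>) d) v {f, f'}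
      (G'\<lparr>edges := (A - {d}) \<union> {f, f'}\<rparr>)"
    by (simp add: delete_edge_def)
qed (use assms in auto)

lemma two_trees_plus_edge_vertex_extension:
  assumes "finite_multigraph G" "two_trees_plus_edge G" "vertex_extension G v F G'" "card F = 2"
  shows "two_trees_plus_edge G'"
proof -
  obtain A B e where dec: "A \<inter> B = {}" "e \<notin> A \<union> B" "edges G = insert e (A \<union> B)"
    "tree (G\<lparr>edges := A\<rparr>)" "tree (G\<lparr>edges := B\<rparr>)"
    using assms(2) by (rule two_trees_plus_edgeE)
  obtain f1 f2 where F: "F = {f1, f2}" "f1 \<noteq> f2" using assms(4) by (auto simp: card_2_iff)
  have "edges G' = edges G \<union> F" "F \<inter> edges G = {}"
    using assms(3) by (auto simp: vertex_extension_def)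
  moreover have "tree (G'\<lparr>edges := insert f1 A\<rparr>)" "tree (G'\<lparr>edges := insert f2 B\<rparr>)"
    using dec F by (auto intro!: tree_edges_update_add_leaf[OF assms(1) _ _ assms(3)])
  ultimately show ?thesis
    using dec F by (intro two_trees_plus_edgeI[of "insert f1 A" "insert f2 B" e]) auto
qed

lemma two_trees_plus_edgeE_avoiding:
  assumes "two_trees_plus_edge G"
  obtains A B e where "A \<inter> B = {}" "e \<notin> A \<union> B" "edges G = insert e (A \<union> B)"
    "tree (G\<lparr>edges := A\<rparr>)" "tree (G\<lparr>edges := B\<rparr>)" "d \<notin> B"
proof -
  obtain A B e where "A \<inter> B = {}" "e \<notin> A \<union> B" "edges G = insert e (A \<union> B)"
    "tree (G\<lparr>edges := A\<rparr>)" "tree (G\<lparr>edges := B\<rparr>)"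
    using assms by (rule two_trees_plus_edgeE)
  then show ?thesis using that[of A B e] that[of B A e] by blast
qed

lemma two_trees_plus_edge_edge_split:
  assumes "finite_multigraph G" "two_trees_plus_edge G" "edge_split G d v F G'" "card F = 3"
  shows "two_trees_plus_edge G'"
proof -
  have ext: "vertex_extension (delete_edge G d) v F G'" and d: "d \<in> edges G"
    using assms(3) by (auto simp: edge_split_def)
  obtain f1 f2 f3 x y z where F: "F = {f1, f2, f3}" "distinct [f1, f2, f3]" "ends G d = {x, y}"
    "ends G' f1 = {v, x}" "ends G' f2 = {v, y}"
    using edge_split_edges[OF assms(3,4)] by metis
  obtain A B e where dec: "A \<inter> B = {}" "e \<notin> A \<union> B" "edges G = insert e (A \<union> B)"
    "tree (G\<lparr>edges := A\<rparr>)" "tree (G\<lparr>edges := B\<rparr>)" "d \<notin> B"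
    using assms(2) by (rule two_trees_plus_edgeE_avoiding)
  have leaf: "tree (G'\<lparr>edges := insert f C\<rparr>)"
    if "tree (G\<lparr>edges := C\<rparr>)" "C \<subseteq> edges G - {d}" "f \<in> F" for C f
    using tree_edges_update_add_leaf[OF finite_multigraph_delete_edge[OF assms(1), of d] _ _ ext]
      that by simp
  have G': "edges G' = (edges G - {d}) \<union> F" "F \<inter> (edges G - {d}) = {}"
    using ext by (auto simp: vertex_extension_def)
  show ?thesis
  proof (cases "d = e")
    case True
    have "tree (G'\<lparr>edges := insert f1 A\<rparr>)" "tree (G'\<lparr>edges := insert f2 B\<rparr>)"
      using leaf dec F(1) True by auto
    then show ?thesis
      using dec F(1,2) G' True
      by (intro two_trees_plus_edgeI[of "insert f1 A" "insert f2 B" f3]) auto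
  next
    case False
    then have "d \<in> A" using dec(3,6) d by blast
    have "tree (G'\<lparr>edges := (A - {d}) \<union> {f1, f2}\<rparr>)"
      using dec(3,4) F \<open>d \<in> A\<close>
      by (intro tree_edges_update_subdivide_edge[OF assms(1) _ _ _ F(3) ext]) auto
    moreover have "tree (G'\<lparr>edges := insert f3 B\<rparr>)"
      using dec(3,6) F(1) by (intro leaf[OF dec(5)]) auto
    ultimately show ?thesis
      using dec(1-3) F(1,2) G' False \<open>d \<in> A\<close>
      by (intro two_trees_plus_edgeI[of "(A - {d}) \<union> {f1, f2}" "insert f3 B" e]) auto
  qed
qed

lemma two_trees_plus_edge_move:
  assumes "finite_multigraph G" "two_trees_plus_edge G" "move G G'"
  shows "two_trees_plus_edge G'"
  using assms(3)
  by (cases rule: move_cases)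
    (auto intro: two_trees_plus_edge_vertex_extension[OF assms(1,2)]
      two_trees_plus_edge_edge_split[OF assms(1,2)])

lemma K11_two_trees_plus_edge:
  assumes "is_K11 G"
  shows "finite_multigraph G \<and> two_trees_plus_edge G"
proof -
  obtain v e where K11: "verts G = {v}" "edges G = {e}" "ends G e = {v}"
    using assms by (auto simp: is_K11_def)
  then have fin: "finite_multigraph G" by (auto simp: finite_multigraph_def multigraph_def)
  have "tree (G\<lparr>edges := {}\<rparr>)"
    using tree_iff_card[OF finite_multigraph_edges_update[OF fin, of "{}"]] K11(1)
    by (simp add: connected_graph_def)
  then show ?thesis using fin K11(2) by (auto intro: two_trees_plus_edgeI[of "{}" "{}" e])
qed

lemma K23_two_trees_plus_edge:
  assumes "is_K23 G"
  shows "finite_multigraph G \<and> two_trees_plus_edge G"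
proof -
  obtain u v e1 e2 e3 where K23: "u \<noteq> v" "distinct [e1, e2, e3]" "verts G = {u, v}"
    "edges G = {e1, e2, e3}" "ends G e1 = {u, v}" "ends G e2 = {u, v}" "ends G e3 = {u, v}"
    using assms by (auto simp: is_K23_def)
  then have fin: "finite_multigraph G" by (auto simp: finite_multigraph_def multigraph_def)
  have single: "tree (G\<lparr>edges := {e}\<rparr>)" if "e \<in> edges G" for e
  proof -
    have "adjacent (G\<lparr>edges := {e}\<rparr>) v u"
      using that K23 by (auto simp: adjacent_def insert_commute)
    then have "connected_graph (G\<lparr>edges := {e}\<rparr>)"
      using K23(3) by (intro connected_graph_from_root[of u]) auto
    then show ?thesis
      using tree_iff_card[OF finite_multigraph_edges_update[OF fin, of "{e}"]] K23(1,3) that by simp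
  qed
  show ?thesis using fin single K23(2,4) by (auto intro: two_trees_plus_edgeI[of "{e1}" "{e2}" e3])
qed

theorem constructible_two_trees_plus_edge:
  assumes "constructible G"
  shows "two_trees_plus_edge G"
proof -
  obtain G0 where G0: "is_K11 G0 \<or> is_K23 G0" "move\<^sup>*\<^sup>* G0 G"
    using assms by (auto simp: constructible_def)
  from G0(2) have "finite_multigraph G \<and> two_trees_plus_edge G"
  proof (induction rule: rtranclp_induct)
    case base
    show ?case using G0(1) K11_two_trees_plus_edge K23_two_trees_plus_edge by blast
  next
    case (step G1 G2)
    then show ?case using finite_multigraph_move two_trees_plus_edge_move by blast
  qed
  then show ?thesis ..
qed

section \<open>Sparse and tight graphs\<close>

lemma sparse_iff_card:
  "sparse k l G \<longleftrightarrow>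
    (\<forall>H. subgraph H G \<and> edges H \<noteq> {} \<longrightarrow> card (edges H) + l \<le> k * card (verts H))"
  unfolding sparse_def by (simp add: le_diff_eq flip: of_nat_mult of_nat_add)

lemma tight_iff_card:
  "tight k l G \<longleftrightarrow> sparse k l G \<and> card (edges G) + l = k * card (verts G)"
  by (auto simp: tight_def eq_diff_eq simp flip: of_nat_mult of_nat_add)

lemma sparse_iff_induced_edges:
  assumes "finite_multigraph G" "l \<le> k"
  shows "sparse k l G \<longleftrightarrow>
    (\<forall>S\<subseteq>verts G. S \<noteq> {} \<longrightarrow> card (induced_edges G S) + l \<le> k * card S)"
proof (intro iffI allI impI)
  note fin = finite_multigraphD[OF assms(1)]
  fix S assume sparse: "sparse k l G" and S: "S \<subseteq> verts G" "S \<noteq> {}"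
  let ?H = "\<lparr>verts = S, edges = induced_edges G S, ends = ends G\<rparr>"
  show "card (induced_edges G S) + l \<le> k * card S"
  proof (cases "induced_edges G S = {}")
    case True
    have "card S > 0" using S fin(2) by (simp add: card_gt_0_iff finite_subset)
    then have "k \<le> k * card S" by (cases "card S") auto
    then show ?thesis unfolding True card.empty using assms(2) by linarith
  next
    case False
    have "multigraph ?H" using fin(1) by (fastforce simp: multigraph_def induced_edges_def)
    then have "subgraph ?H G" using S(1) by (auto simp: subgraph_def induced_edges_def)
    then show ?thesis using sparse False by (auto simp: sparse_iff_card)
  qed
next
  assume induced: "\<forall>S\<subseteq>verts G. S \<noteq> {} \<longrightarrow> card (induced_edges G S) + l \<le> k * card S"
  have "card (edges H) + l \<le> k * card (verts H)" if H: "subgraph H G" "edges H \<noteq> {}" for H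
  proof -
    have "verts H \<subseteq> verts G" "verts H \<noteq> {}" using H by (auto simp: subgraph_def multigraph_def)
    then have "card (induced_edges G (verts H)) + l \<le> k * card (verts H)" using induced by blast
    moreover have "edges H \<subseteq> induced_edges G (verts H)"
      using H by (fastforce simp: subgraph_def multigraph_def induced_edges_def)
    then have "card (edges H) \<le> card (induced_edges G (verts H))"
      using finite_induced_edges[OF assms(1)] by (rule card_mono[rotated])
    ultimately show ?thesis by linarith
  qed
  then show "sparse k l G" by (auto simp: sparse_iff_card)
qed

lemma sparse_card_induced_edges:
  assumes "finite_multigraph G" "l \<le> k" "sparse k l G" "S \<subseteq> verts G" "S \<noteq> {}"
  shows "card (induced_edges G S) + l \<le> k * card S"
  using assms sparse_iff_induced_edges by blast

lemma sparse_mono: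
  assumes "sparse k l G" "verts G' \<subseteq> verts G" "edges G' \<subseteq> edges G"
    and "\<And>e. e \<in> edges G' \<Longrightarrow> ends G' e = ends G e"
  shows "sparse k l G'"
  unfolding sparse_iff_card
proof (intro allI impI)
  fix H assume H: "subgraph H G' \<and> edges H \<noteq> {}"
  let ?H = "H\<lparr>ends := ends G\<rparr>"
  have "subgraph ?H G" "edges ?H \<noteq> {}"
    using H assms(2-4) by (auto simp: subgraph_def multigraph_def subset_iff)
  then have "card (edges ?H) + l \<le> k * card (verts ?H)"
    using assms(1) unfolding sparse_iff_card by blast
  then show "card (edges H) + l \<le> k * card (verts H)" by simp
qed

lemma tight_cong:
  assumes "verts G' = verts G" "edges G' = edges G" "\<And>e. e \<in> edges G \<Longrightarrow> ends G' e = ends G e"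
  shows "tight k l G' \<longleftrightarrow> tight k l G"
  using sparse_mono[of k l G G'] sparse_mono[of k l G' G] assms by (auto simp: tight_iff_card)

lemma tree_tight:
  assumes "finite_multigraph T" "tree T"
  shows "tight 1 1 T"
proof -
  have T: "connected_graph T" "Suc (card (edges T)) = card (verts T)"
    using assms tree_iff_card by auto
  have "card (induced_edges T S) + 1 \<le> 1 * card S" if S: "S \<subseteq> verts T" "S \<noteq> {}" for S
  proof -
    have "card (edges T) = card (edges T - induced_edges T S) + card (induced_edges T S)"
      using finite_multigraphD(3)[OF assms(1)]
      by (intro card_eq_card_Diff_plus) (auto simp: induced_edges_def)
    then show ?thesis using connected_graph_card_verts_le[OF assms(1) T(1) S] T(2) by linarith
  qed
  then show ?thesis
    using sparse_iff_induced_edges[OF assms(1), of 1 1] T(2) by (simp add: tight_iff_card)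
qed

lemma tight_edge_union:
  assumes "finite_multigraph G" "edges G = A \<union> B" "A \<inter> B = {}"
    and "tight k l (G\<lparr>edges := A\<rparr>)" "tight k' l' (G\<lparr>edges := B\<rparr>)" "l \<le> k" "l' \<le> k'"
  shows "tight (k + k') (l + l') G"
proof -
  let ?A = "G\<lparr>edges := A\<rparr>" and ?B = "G\<lparr>edges := B\<rparr>"
  have fin: "finite_multigraph ?A" "finite_multigraph ?B"
    using assms(1,2) by (auto intro: finite_multigraph_edges_update)
  have "card (induced_edges G S) + (l + l') \<le> (k + k') * card S"
    if S: "S \<subseteq> verts G" "S \<noteq> {}" for S
  proof -
    have "induced_edges G S = induced_edges ?A S \<union> induced_edges ?B S"
      using assms(2) by (auto simp: induced_edges_def)
    then have "card (induced_edges G S) \<le> card (induced_edges ?A S) + card (induced_edges ?B S)"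
      by (simp add: card_Un_le)
    moreover have "card (induced_edges ?A S) + l \<le> k * card S"
      by (rule sparse_card_induced_edges[OF fin(1) assms(6)])
        (use assms(4) S in \<open>auto simp: tight_def\<close>)
    moreover have "card (induced_edges ?B S) + l' \<le> k' * card S"
      by (rule sparse_card_induced_edges[OF fin(2) assms(7)])
        (use assms(5) S in \<open>auto simp: tight_def\<close>)
    ultimately show ?thesis unfolding distrib_right by linarith
  qed
  then have "sparse (k + k') (l + l') G"
    using sparse_iff_induced_edges[OF assms(1)] assms(6,7) by simp
  moreover have "card (edges G) = card A + card B"
    using finite_multigraphD(3)[OF assms(1)] assms(2,3) by (simp add: card_Un_disjoint)
  ultimately show ?thesis using assms(4,5) by (simp add: tight_iff_card distrib_right)
qed

lemma tight_insert_edge: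
  assumes "finite_multigraph G" "e \<in> edges G" "Suc l \<le> k" "tight k (Suc l) (delete_edge G e)"
  shows "tight k l G"
proof -
  note fin = finite_multigraph_delete_edge[OF assms(1), of e]
  have "card (induced_edges G S) + l \<le> k * card S" if S: "S \<subseteq> verts G" "S \<noteq> {}" for S
  proof -
    have "induced_edges G S \<subseteq> insert e (induced_edges (delete_edge G e) S)"
      by (auto simp: induced_edges_def)
    then have "card (induced_edges G S) \<le> card (insert e (induced_edges (delete_edge G e) S))"
      using finite_induced_edges[OF fin] by (intro card_mono) auto
    also have "\<dots> \<le> Suc (card (induced_edges (delete_edge G e) S))"
      by (simp add: card_insert_le_m1 finite_induced_edges[OF fin] card_insert_if)
    finally have "card (induced_edges G S) \<le> Suc (card (induced_edges (delete_edge G e) S))" .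
    moreover have "card (induced_edges (delete_edge G e) S) + Suc l \<le> k * card S"
      by (rule sparse_card_induced_edges[OF fin assms(3)])
        (use assms(4) S in \<open>auto simp: tight_def\<close>)
    ultimately show ?thesis by linarith
  qed
  then have "sparse k l G" using sparse_iff_induced_edges[OF assms(1)] assms(3) by simp
  moreover have "card (edges G) + l = k * card (verts G)"
    using assms(4) card_edges_delete_edge[OF assms(1,2)] by (simp add: tight_iff_card)
  ultimately show ?thesis by (simp add: tight_iff_card)
qed

lemma P21_graph_iff:
  assumes "finite_multigraph G"
  shows "P21_graph G \<longleftrightarrow> (\<exists>e\<in>edges G. tight 2 2 (delete_edge G e))"
proof -
  have "tight 2 1 G" if "e \<in> edges G" "tight 2 2 (delete_edge G e)" for e
    using tight_insert_edge[OF assms that(1), of 1 2] that(2) by (simp add: numeral_2_eq_2)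
  then show ?thesis unfolding P21_graph_def by blast
qed

theorem two_trees_plus_edge_P21_graph:
  assumes "finite_multigraph G" "two_trees_plus_edge G"
  shows "P21_graph G"
proof -
  obtain A B e where dec: "A \<inter> B = {}" "e \<notin> A \<union> B" "edges G = insert e (A \<union> B)"
    "tree (G\<lparr>edges := A\<rparr>)" "tree (G\<lparr>edges := B\<rparr>)"
    using assms(2) by (rule two_trees_plus_edgeE)
  have "tight 1 1 (G\<lparr>edges := C\<rparr>)" if "tree (G\<lparr>edges := C\<rparr>)" "C \<subseteq> edges G" for C
    using tree_tight finite_multigraph_edges_update[OF assms(1)] that by blast
  then have "tight (1 + 1) (1 + 1) (delete_edge G e)"
    using dec by (intro tight_edge_union[of _ A B] finite_multigraph_delete_edge assms(1))
      (auto simp: delete_edge_def)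
  then show ?thesis using P21_graph_iff[OF assms(1)] dec(3) by (auto simp: numeral_2_eq_2)
qed

section \<open>Degrees in tight graphs\<close>

lemma sparse_card_ends:
  assumes "finite_multigraph G" "sparse k l G" "k \<le> l" "e \<in> edges G"
  shows "card (ends G e) = 2"
proof -
  obtain u v where uv: "u \<in> verts G" "v \<in> verts G" "ends G e = {u, v}"
    using multigraph_ends[OF finite_multigraphD(1)[OF assms(1)] assms(4)] .
  have "u \<noteq> v"
  proof
    assume "u = v"
    then have "subgraph \<lparr>verts = {u}, edges = {e}, ends = ends G\<rparr> G"
      using uv assms(4) by (auto simp: subgraph_def multigraph_def)
    then have "1 + l \<le> k" using assms(2) unfolding sparse_iff_card by fastforce
    then show False using assms(3) by simp
  qed
  then show ?thesis using uv(3) by simp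
qed

lemma sparse_delete_edge_card_ends:
  assumes "finite_multigraph G" "sparse k l (delete_edge G e)" "k \<le> l" "f \<in> edges G" "f \<noteq> e"
  shows "card (ends G f) = 2"
  using sparse_card_ends[OF finite_multigraph_delete_edge[OF assms(1)] assms(2,3), of f] assms(4,5)
  by simp

lemma sparse_adjacent_verts:
  assumes "finite_multigraph G" "sparse k l G" "k \<le> l" "adjacent G v x"
  shows "x \<in> verts G - {v}"
proof -
  obtain e where e: "e \<in> edges G" "ends G e = {v, x}"
    using assms(4) by (auto simp: adjacent_def)
  then have "x \<noteq> v" using sparse_card_ends[OF assms(1-3) e(1)] by auto
  then show ?thesis
    using e multigraph_ends_subset[OF finite_multigraphD(1)[OF assms(1)], of e] by auto
qed

lemma sum_card_incident:
  assumes "finite_multigraph G" "\<And>e. e \<in> edges G \<Longrightarrow> card (ends G e) = 2"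
  shows "(\<Sum>v\<in>verts G. card (incident G v)) = 2 * card (edges G)"
  unfolding incident_def
proof (rule sum_multicount)
  show "\<forall>e\<in>edges G. card {v \<in> verts G. v \<in> ends G e} = 2"
  proof
    fix e assume e: "e \<in> edges G"
    then have "{v \<in> verts G. v \<in> ends G e} = ends G e"
      using multigraph_ends_subset[OF finite_multigraphD(1)[OF assms(1)]] by blast
    then show "card {v \<in> verts G. v \<in> ends G e} = 2" using assms(2)[OF e] by simp
  qed
qed (use finite_multigraphD[OF assms(1)] in auto)

lemma tight_card_incident_ge:
  assumes "finite_multigraph G" "tight k l G" "l \<le> k" "v \<in> verts G" "verts G \<noteq> {v}"
  shows "k \<le> card (incident G v)"
proof -
  note fin = finite_multigraphD[OF assms(1)]
  have "edges G = induced_edges G (verts G - {v}) \<union> incident G v"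
    using multigraph_ends_subset[OF fin(1)] by (auto simp: induced_edges_def incident_def)
  then have "card (edges G) \<le> card (induced_edges G (verts G - {v})) + card (incident G v)"
    by (metis card_Un_le)
  moreover have "card (induced_edges G (verts G - {v})) + l \<le> k * card (verts G - {v})"
    using assms by (intro sparse_card_induced_edges) (auto simp: tight_def)
  moreover have "k * card (verts G) = k * card (verts G - {v}) + k"
    using card.remove[OF fin(2) assms(4)] by simp
  ultimately show ?thesis using assms(2) unfolding tight_iff_card by linarith
qed

lemma tight_sum_card_incident:
  assumes "finite_multigraph G" "tight k l G" "k \<le> l"
  shows "(\<Sum>v\<in>verts G. card (incident G v)) + 2 * l = 2 * k * card (verts G)"
proof -
  have "(\<Sum>v\<in>verts G. card (incident G v)) = 2 * card (edges G)"
    using assms(2) sparse_card_ends[OF assms(1) _ assms(3)]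
    by (intro sum_card_incident assms(1)) (auto simp: tight_def)
  then show ?thesis using assms(2) by (simp add: tight_iff_card algebra_simps)
qed

text \<open>The degrees of a \<open>(k,k)\<close>-tight graph add up to \<open>2k|V| - 2k\<close>, so if every vertex off a given
  pair has degree at least \<open>2k\<close>, then the pair absorbs the whole deficit.\<close>

lemma tight_small_degree_vertex:
  assumes "finite_multigraph G" "tight k k G" "k > 0" "card (verts G) \<ge> 2"
    and "p \<in> verts G" "q \<in> verts G"
  shows "(\<exists>v\<in>verts G - {p, q}. card (incident G v) < 2 * k) \<or>
    (p \<noteq> q \<and> card (incident G p) = k \<and> card (incident G q) = k)"
proof (rule disjCI, rule ccontr)
  let ?D = "{p, q}" and ?deg = "\<lambda>v. card (incident G v)"
  assume off: "\<not> (p \<noteq> q \<and> ?deg p = k \<and> ?deg q = k)"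
  assume "\<not> (\<exists>v\<in>verts G - ?D. ?deg v < 2 * k)"
  then have "(\<Sum>v\<in>verts G - ?D. 2 * k) \<le> (\<Sum>v\<in>verts G - ?D. ?deg v)"
    by (intro sum_mono) (simp add: not_less)
  moreover have "(\<Sum>v\<in>verts G. ?deg v) = (\<Sum>v\<in>verts G - ?D. ?deg v) + (\<Sum>v\<in>?D. ?deg v)"
    using assms by (intro sum.subset_diff) (auto simp: finite_multigraph_def)
  moreover have "card (verts G) = card (verts G - ?D) + card ?D"
    using assms(5,6) finite_multigraphD(2)[OF assms(1)]
    by (intro card_eq_card_Diff_plus) auto
  ultimately have deficit: "(\<Sum>v\<in>?D. ?deg v) + 2 * k \<le> 2 * k * card ?D"
    using tight_sum_card_incident[OF assms(1,2)] by (simp add: algebra_simps)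
  have "verts G \<noteq> {v}" for v using assms(4) by auto
  then have deg_ge: "k \<le> ?deg p" "k \<le> ?deg q"
    using assms by (auto intro: tight_card_incident_ge)
  show False
  proof (cases "p = q")
    case True
    then show False using deficit deg_ge assms(3) by simp
  next
    case False
    then have "?deg p + ?deg q \<le> 2 * k" using deficit by simp
    then show False using deg_ge off False by linarith
  qed
qed

section \<open>Tight sets\<close>

definition tight_set :: "nat \<Rightarrow> nat \<Rightarrow> ('v, 'e) mgraph \<Rightarrow> 'v set \<Rightarrow> bool" where
  "tight_set k l G S \<longleftrightarrow>
     S \<subseteq> verts G \<and> S \<noteq> {} \<and> card (induced_edges G S) + l = k * card S"

lemma card_induced_edges_supermodular:
  assumes "finite_multigraph G"
  shows "card (induced_edges G S) + card (induced_edges G T)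
    \<le> card (induced_edges G (S \<union> T)) + card (induced_edges G (S \<inter> T))"
proof -
  note fin = finite_induced_edges[OF assms]
  have "card (induced_edges G S) + card (induced_edges G T)
    = card (induced_edges G S \<union> induced_edges G T) + card (induced_edges G S \<inter> induced_edges G T)"
    by (rule card_Un_Int[OF fin fin])
  moreover have "induced_edges G S \<inter> induced_edges G T = induced_edges G (S \<inter> T)"
    by (auto simp: induced_edges_def)
  moreover have "card (induced_edges G S \<union> induced_edges G T) \<le> card (induced_edges G (S \<union> T))"
    by (rule card_mono[OF fin]) (auto simp: induced_edges_def)
  ultimately show ?thesis by simp
qed

lemma tight_set_Un:
  assumes "finite_multigraph G" "l \<le> k" "sparse k l G"
    and "tight_set k l G S" "tight_set k l G T" "S \<inter> T \<noteq> {}"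
  shows "tight_set k l G (S \<union> T)"
proof -
  note sparse = sparse_card_induced_edges[OF assms(1-3)]
  have "finite S" "finite T"
    using assms(4,5) finite_multigraphD(2)[OF assms(1)] by (auto simp: tight_set_def finite_subset)
  then have "k * card S + k * card T = k * card (S \<union> T) + k * card (S \<inter> T)"
    by (metis card_Un_Int distrib_left)
  moreover have "card (induced_edges G (S \<union> T)) + l \<le> k * card (S \<union> T)"
    "card (induced_edges G (S \<inter> T)) + l \<le> k * card (S \<inter> T)"
    using assms(4-6) by (auto simp: tight_set_def intro!: sparse)
  ultimately have "card (induced_edges G (S \<union> T)) + l = k * card (S \<union> T)"
    using card_induced_edges_supermodular[OF assms(1), of S T] assms(4,5)
    unfolding tight_set_def by linarith
  then show ?thesis using assms(4,5) by (auto simp: tight_set_def)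
qed

lemma tight_set_neighbours_card_incident_le:
  assumes "finite_multigraph G" "l \<le> k" "sparse k l G" "tight_set k l G S"
    and "v \<in> verts G - S" "\<And>x. adjacent G v x \<Longrightarrow> x \<in> S"
  shows "card (incident G v) \<le> k"
proof -
  note fin = finite_multigraphD[OF assms(1)]
  have S: "S \<subseteq> verts G" "card (induced_edges G S) + l = k * card S"
    using assms(4) by (auto simp: tight_set_def)
  have "incident G v \<subseteq> induced_edges G (insert v S)"
  proof
    fix e assume e: "e \<in> incident G v"
    then obtain x where "ends G e = {v, x}" using incident_other_end[OF fin(1)] by metis
    moreover from this have "x \<in> S" using e assms(6) by (auto simp: adjacent_def incident_def)
    ultimately show "e \<in> induced_edges G (insert v S)"
      using e by (auto simp: induced_edges_def incident_def)
  qed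
  then have "induced_edges G S \<union> incident G v \<subseteq> induced_edges G (insert v S)"
    by (auto simp: induced_edges_def)
  then have "card (induced_edges G S \<union> incident G v) \<le> card (induced_edges G (insert v S))"
    using finite_induced_edges[OF assms(1)] by (rule card_mono[rotated])
  moreover have "card (induced_edges G S \<union> incident G v)
      = card (induced_edges G S) + card (incident G v)"
    using assms(5) finite_induced_edges[OF assms(1)] finite_incident[OF assms(1)]
    by (intro card_Un_disjoint) (auto simp: induced_edges_def incident_def)
  moreover have "card (induced_edges G (insert v S)) + l \<le> k * card (insert v S)"
    by (rule sparse_card_induced_edges[OF assms(1-3)]) (use S(1) assms(5) in auto)
  moreover have "k * card (insert v S) = k * card S + k"
    using assms(5) finite_subset[OF S(1) fin(2)] by simp
  ultimately show ?thesis using S(2) by linarith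
qed

lemma tight_set_covering:
  assumes "finite_multigraph G" "l \<le> k" "sparse k l G" "finite M" "M \<noteq> {}"
    and "\<And>y. y \<in> M \<Longrightarrow> \<exists>S. tight_set k l G S \<and> v \<notin> S \<and> x \<in> S \<and> y \<in> S"
  shows "\<exists>S. tight_set k l G S \<and> v \<notin> S \<and> x \<in> S \<and> M \<subseteq> S"
  using assms(4-6)
proof (induction M rule: finite_ne_induct)
  case (insert y M)
  then obtain S where S: "tight_set k l G S" "v \<notin> S" "x \<in> S" "M \<subseteq> S" by blast
  obtain T where T: "tight_set k l G T" "v \<notin> T" "x \<in> T" "y \<in> T" using insert.prems by blast
  have "tight_set k l G (S \<union> T)" using S T by (intro tight_set_Un[OF assms(1-3)]) auto
  then show ?case using S T by blast
qed simp

text \<open>If no two neighbours of \<open>v\<close> were separable, the tight sets joining a fixed neighbour to the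
  others would have a tight union, which is overfull once \<open>v\<close> is added.\<close>

lemma sparse_separable_neighbours:
  assumes "finite_multigraph G" "sparse k k G" "v \<in> verts G" "k < card (incident G v)"
  shows "\<exists>x y. adjacent G v x \<and> adjacent G v y \<and> x \<noteq> y \<and>
    (\<forall>S. tight_set k k G S \<longrightarrow> v \<notin> S \<longrightarrow> \<not> {x, y} \<subseteq> S)"
proof (rule ccontr)
  assume contra: "\<not> ?thesis"
  note fin = finite_multigraphD[OF assms(1)]
  define N where "N = {x. adjacent G v x}"
  have N: "N \<subseteq> verts G - {v}"
    using sparse_adjacent_verts[OF assms(1,2) order_refl] by (auto simp: N_def)
  have "incident G v \<noteq> {}" using assms(4) by auto
  then obtain x where x: "x \<in> N"
    using incident_other_end[OF fin(1)] unfolding N_def adjacent_def incident_def by blast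
  have singleton: "tight_set k k G {x}"
    using sparse_card_induced_edges[OF assms(1) order_refl assms(2), of "{x}"] N x
    by (auto simp: tight_set_def)
  have "\<exists>S. tight_set k k G S \<and> v \<notin> S \<and> x \<in> S \<and> y \<in> S" if "y \<in> N" for y
  proof (cases "y = x")
    case True
    then show ?thesis using singleton N x by blast
  next
    case False
    then show ?thesis using contra that x unfolding N_def by blast
  qed
  moreover have "finite N" using N fin(2) by (meson finite_Diff finite_subset)
  ultimately obtain S where "tight_set k k G S" "v \<notin> S" "N \<subseteq> S"
    using tight_set_covering[OF assms(1) order_refl assms(2), of N v x] x by blast
  then have "card (incident G v) \<le> k"
    using assms(3)
    by (intro tight_set_neighbours_card_incident_le[OF assms(1) order_refl assms(2)])
      (auto simp: N_def)
  then show False using assms(4) by simp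
qed

lemma tight_no_separation:
  assumes "finite_multigraph G" "tight k l G" "0 < l" "l \<le> k" "S \<subseteq> verts G" "S \<noteq> {}"
    and "\<And>e. e \<in> edges G \<Longrightarrow> ends G e \<subseteq> S \<or> ends G e \<inter> S = {}"
  shows "S = verts G"
proof (rule ccontr)
  assume "S \<noteq> verts G"
  note fin = finite_multigraphD[OF assms(1)]
  let ?R = "verts G - S"
  have sparse: "sparse k l G" using assms(2) by (simp add: tight_def)
  have "edges G = induced_edges G S \<union> induced_edges G ?R"
    using assms(7) multigraph_ends_subset[OF fin(1)] by (fastforce simp: induced_edges_def)
  then have "card (edges G) \<le> card (induced_edges G S) + card (induced_edges G ?R)"
    by (metis card_Un_le)
  moreover have "card (induced_edges G S) + l \<le> k * card S"
    "card (induced_edges G ?R) + l \<le> k * card ?R"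
    using assms(5,6) \<open>S \<noteq> verts G\<close>
    by (auto intro!: sparse_card_induced_edges[OF assms(1,4) sparse])
  moreover have "k * card (verts G) = k * card ?R + k * card S"
    using card_eq_card_Diff_plus[OF fin(2) assms(5)] by (simp only: distrib_left)
  ultimately show False using assms(2,3) unfolding tight_iff_card by linarith
qed

section \<open>Inverse moves\<close>

definition delete_vertex :: "('v, 'e) mgraph \<Rightarrow> 'v \<Rightarrow> ('v, 'e) mgraph" where
  "delete_vertex G v = \<lparr>verts = verts G - {v}, edges = edges G - incident G v, ends = ends G\<rparr>"

definition add_edge :: "('v, 'e) mgraph \<Rightarrow> 'e \<Rightarrow> 'v \<Rightarrow> 'v \<Rightarrow> ('v, 'e) mgraph" where
  "add_edge G e x y =
     \<lparr>verts = verts G, edges = insert e (edges G), ends = (ends G)(e := {x, y})\<rparr>"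

lemma delete_vertex_simps [simp]:
  "verts (delete_vertex G v) = verts G - {v}"
  "edges (delete_vertex G v) = edges G - incident G v"
  "ends (delete_vertex G v) = ends G"
  by (simp_all add: delete_vertex_def)

lemma add_edge_simps [simp]:
  "verts (add_edge G e x y) = verts G"
  "edges (add_edge G e x y) = insert e (edges G)"
  "ends (add_edge G e x y) = (ends G)(e := {x, y})"
  by (simp_all add: add_edge_def)

lemma finite_multigraph_delete_vertex:
  assumes "finite_multigraph G"
  shows "finite_multigraph (delete_vertex G v)"
proof -
  have "\<exists>x\<in>verts G - {v}. \<exists>y\<in>verts G - {v}. ends G e = {x, y}" if "e \<in> edges G - incident G v" for e
    using that assms by (fastforce simp: finite_multigraph_def multigraph_def incident_def)
  then show ?thesis using assms by (auto simp: finite_multigraph_def multigraph_def)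
qed

lemma finite_multigraph_add_edge:
  "finite_multigraph G \<Longrightarrow> x \<in> verts G \<Longrightarrow> y \<in> verts G \<Longrightarrow> finite_multigraph (add_edge G e x y)"
  by (auto simp: finite_multigraph_def multigraph_def)

lemma card_edges_delete_vertex:
  assumes "finite_multigraph G"
  shows "card (edges G) = card (edges (delete_vertex G v)) + card (incident G v)"
proof -
  have "incident G v \<subseteq> edges G" by (auto simp: incident_def)
  then show ?thesis
    unfolding delete_vertex_simps
    by (rule card_eq_card_Diff_plus[OF finite_multigraphD(3)[OF assms]])
qed

lemma card_verts_delete_vertex:
  "finite_multigraph G \<Longrightarrow> v \<in> verts G \<Longrightarrow> card (verts G) = Suc (card (verts (delete_vertex G v)))"
  unfolding delete_vertex_simps by (rule card.remove[OF finite_multigraphD(2)])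

lemma sparse_delete_vertex: "sparse k l G \<Longrightarrow> sparse k l (delete_vertex G v)"
  by (rule sparse_mono) auto

lemma tight_delete_vertex:
  assumes "finite_multigraph G" "tight k l G" "v \<in> verts G" "card (incident G v) = k"
  shows "tight k l (delete_vertex G v)"
  using assms sparse_delete_vertex[of k l G v] card_edges_delete_vertex[OF assms(1), of v]
    card_verts_delete_vertex[OF assms(1,3)]
  by (simp add: tight_iff_card del: delete_vertex_simps)

lemma sparse_add_edge:
  assumes "finite_multigraph G" "l \<le> k" "sparse k l G" "e \<notin> edges G" "x \<in> verts G" "y \<in> verts G"
    and "\<And>S. tight_set k l G S \<Longrightarrow> \<not> {x, y} \<subseteq> S"
  shows "sparse k l (add_edge G e x y)"
proof -
  let ?H = "add_edge G e x y"
  have "card (induced_edges ?H S) + l \<le> k * card S" if S: "S \<subseteq> verts ?H" "S \<noteq> {}" for S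
  proof -
    have bound: "card (induced_edges G S) + l \<le> k * card S"
      using S by (intro sparse_card_induced_edges[OF assms(1-3)]) auto
    show ?thesis
    proof (cases "{x, y} \<subseteq> S")
      case True
      then have "induced_edges ?H S = insert e (induced_edges G S)"
        using assms(4) by (auto simp: induced_edges_def)
      then have "card (induced_edges ?H S) = Suc (card (induced_edges G S))"
        using assms(4) finite_induced_edges[OF assms(1)] by (simp add: induced_edges_def)
      moreover have "card (induced_edges G S) + l \<noteq> k * card S"
        using True S assms(7)[of S] by (auto simp: tight_set_def)
      ultimately show ?thesis using bound by linarith
    next
      case False
      then have "induced_edges ?H S = induced_edges G S"
        using assms(4) by (auto simp: induced_edges_def)
      then show ?thesis using bound by simp
    qed
  qed
  then show ?thesis
    using sparse_iff_induced_edges[OF finite_multigraph_add_edge[OF assms(1,5,6)] assms(2)] by blast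
qed

lemma tight_delete_vertex_add_edge:
  assumes "finite_multigraph G" "l \<le> k" "tight k l G" "v \<in> verts G" "card (incident G v) = Suc k"
    and "a \<in> incident G v" "x \<in> verts G - {v}" "y \<in> verts G - {v}"
    and "\<And>S. tight_set k l G S \<Longrightarrow> v \<notin> S \<Longrightarrow> \<not> {x, y} \<subseteq> S"
  shows "tight k l (add_edge (delete_vertex G v) a x y)"
proof -
  let ?H = "delete_vertex G v"
  note fin = finite_multigraph_delete_vertex[OF assms(1)]
  have "sparse k l (add_edge ?H a x y)"
  proof (rule sparse_add_edge[OF fin assms(2)])
    show "sparse k l ?H" using assms(3) sparse_delete_vertex by (auto simp: tight_def)
    fix S assume "tight_set k l ?H S"
    moreover from this have "induced_edges ?H S = induced_edges G S"
      by (auto simp: induced_edges_def incident_def tight_set_def)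
    ultimately show "\<not> {x, y} \<subseteq> S" using assms(9)[of S] by (auto simp: tight_set_def)
  qed (use assms in auto)
  moreover have "card (edges (add_edge ?H a x y)) = Suc (card (edges ?H))"
    using finite_multigraphD(3)[OF fin, of v] assms(6) by simp
  ultimately show ?thesis
    using assms(3,5) card_edges_delete_vertex[OF assms(1), of v]
      card_verts_delete_vertex[OF assms(1,4)]
    by (simp add: tight_iff_card del: delete_vertex_simps add_edge_simps(2))
qed

lemma vertex_extension_delete_vertex:
  assumes "multigraph G" "v \<in> verts G" "\<And>e. e \<in> incident G v \<Longrightarrow> card (ends G e) = 2"
  shows "vertex_extension (delete_vertex G v) v (incident G v) G"
proof -
  have "\<exists>x\<in>verts G - {v}. ends G e = {v, x}" if e: "e \<in> incident G v" for e
  proof -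
    obtain x where "x \<in> verts G" "ends G e = {v, x}" using incident_other_end[OF assms(1) e] .
    moreover from this have "x \<noteq> v" using assms(3)[OF e] by auto
    ultimately show ?thesis by blast
  qed
  then show ?thesis using assms(2) by (auto simp: vertex_extension_def incident_def)
qed

lemma edge_split_delete_vertex_add_edge:
  assumes "multigraph G" "v \<in> verts G" "\<And>e. e \<in> incident G v \<Longrightarrow> card (ends G e) = 2"
    and "a \<in> incident G v" "adjacent G v x" "adjacent G v y" "x \<noteq> y"
  shows "edge_split (add_edge (delete_vertex G v) a x y) a v (incident G v) G"
proof -
  let ?H = "add_edge (delete_vertex G v) a x y"
  have "vertex_extension (delete_edge ?H a) v (incident G v) G"
    using vertex_extension_delete_vertex[OF assms(1-3)] assms(4)
    by (auto simp: vertex_extension_def)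
  moreover have "{{v, x}, {v, y}} \<subseteq> ends G ` incident G v"
    using assms(5,6) by (auto simp: adjacent_def incident_def)
  ultimately show ?thesis using assms(7) by (auto simp: edge_split_def)
qed

section \<open>Reduction of P(2,1)-graphs\<close>

lemma incident_delete_edge: "incident (delete_edge G e) v = incident G v - {e}"
  by (auto simp: incident_def)

lemma P21_graph_delete_vertex:
  assumes "finite_multigraph G" "e \<in> edges G" "tight 2 2 (delete_edge G e)"
    and "v \<in> verts G - ends G e" "card (incident G v) = 2"
  shows "P21_graph (delete_vertex G v)"
proof -
  have incident_eq: "incident (delete_edge G e) v = incident G v"
    using assms(4) by (auto simp: incident_def)
  have "tight 2 2 (delete_vertex (delete_edge G e) v)"
    using assms incident_eq by (intro tight_delete_vertex finite_multigraph_delete_edge) auto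
  moreover have "tight 2 2 (delete_edge (delete_vertex G v) e) \<longleftrightarrow>
      tight 2 2 (delete_vertex (delete_edge G e) v)"
    by (rule tight_cong) (auto simp: incident_eq)
  ultimately show ?thesis
    using P21_graph_iff[OF finite_multigraph_delete_vertex[OF assms(1)]] assms(2,4)
    by (auto simp: incident_def)
qed

lemma P21_graph_delete_vertex_add_edge:
  assumes "finite_multigraph G" "e \<in> edges G" "tight 2 2 (delete_edge G e)"
    and "v \<in> verts G - ends G e" "card (incident G v) = 3" "a \<in> incident G v"
    and "x \<in> verts G - {v}" "y \<in> verts G - {v}"
    and "\<And>S. tight_set 2 2 (delete_edge G e) S \<Longrightarrow> v \<notin> S \<Longrightarrow> \<not> {x, y} \<subseteq> S"
  shows "P21_graph (add_edge (delete_vertex G v) a x y)"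
proof -
  have incident_eq: "incident (delete_edge G e) v = incident G v" and "a \<noteq> e"
    using assms(4,6) by (auto simp: incident_def)
  have "tight 2 2 (add_edge (delete_vertex (delete_edge G e) v) a x y)"
    using assms incident_eq
    by (intro tight_delete_vertex_add_edge finite_multigraph_delete_edge) auto
  moreover have "tight 2 2 (delete_edge (add_edge (delete_vertex G v) a x y) e) \<longleftrightarrow>
      tight 2 2 (add_edge (delete_vertex (delete_edge G e) v) a x y)"
    using \<open>a \<noteq> e\<close> by (intro tight_cong) (auto simp: incident_eq)
  moreover have "finite_multigraph (add_edge (delete_vertex G v) a x y)"
    using assms(7,8)
    by (intro finite_multigraph_add_edge finite_multigraph_delete_vertex assms(1)) auto
  ultimately show ?thesis using P21_graph_iff assms(2,4) by (fastforce simp: incident_def)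
qed

text \<open>At an end of \<open>e\<close> the new edge takes over the role of \<open>e\<close>: what remains without it is tight
  already.\<close>

lemma P21_graph_delete_end_add_edge:
  assumes "finite_multigraph G" "tight 2 2 (delete_edge G e)" "e \<in> incident G p"
    and "p \<in> verts G" "card (incident (delete_edge G e) p) = 2" "a \<in> incident G p"
    and "x \<in> verts G - {p}" "y \<in> verts G - {p}"
  shows "P21_graph (add_edge (delete_vertex G p) a x y)"
proof -
  have "tight 2 2 (delete_vertex (delete_edge G e) p)"
    using assms by (intro tight_delete_vertex finite_multigraph_delete_edge) auto
  moreover have "tight 2 2 (delete_edge (add_edge (delete_vertex G p) a x y) a) \<longleftrightarrow>
      tight 2 2 (delete_vertex (delete_edge G e) p)"
    using assms(3,6) by (intro tight_cong) (auto simp: incident_delete_edge)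
  moreover have "finite_multigraph (add_edge (delete_vertex G p) a x y)"
    using assms(7,8)
    by (intro finite_multigraph_add_edge finite_multigraph_delete_vertex assms(1)) auto
  ultimately show ?thesis using P21_graph_iff by fastforce
qed

lemma P21_graph_reduce_degree_2:
  assumes "finite_multigraph G" "e \<in> edges G" "tight 2 2 (delete_edge G e)"
    and "v \<in> verts G - ends G e" "card (incident G v) = 2"
  shows "\<exists>G'. finite_multigraph G' \<and> P21_graph G' \<and> move G' G"
proof -
  have sparse: "sparse 2 2 (delete_edge G e)" using assms(3) by (simp add: tight_def)
  have "card (ends G f) = 2" if "f \<in> incident G v" for f
    using that assms(4) sparse_delete_edge_card_ends[OF assms(1) sparse order_refl]
    by (auto simp: incident_def)
  then have "vertex_extension (delete_vertex G v) v (incident G v) G"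
    using assms(4) finite_multigraphD(1)[OF assms(1)]
    by (intro vertex_extension_delete_vertex) auto
  then have "move (delete_vertex G v) G" using assms(5) by (rule move_if_vertex_extension)
  then show ?thesis
    using finite_multigraph_delete_vertex[OF assms(1)] P21_graph_delete_vertex[OF assms] by blast
qed

lemma P21_graph_reduce_degree_3:
  assumes "finite_multigraph G" "e \<in> edges G" "tight 2 2 (delete_edge G e)"
    and "v \<in> verts G - ends G e" "card (incident G v) = 3"
  shows "\<exists>G'. finite_multigraph G' \<and> P21_graph G' \<and> move G' G"
proof -
  let ?H = "delete_edge G e"
  note fin = finite_multigraph_delete_edge[OF assms(1), of e]
  have sparse: "sparse 2 2 ?H" using assms(3) by (simp add: tight_def)
  have incident_eq: "incident ?H v = incident G v" using assms(4) by (auto simp: incident_def)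
  have loopless: "card (ends G f) = 2" if "f \<in> incident G v" for f
    using that assms(4) sparse_delete_edge_card_ends[OF assms(1) sparse order_refl]
    by (auto simp: incident_def)
  obtain x y where xy: "adjacent ?H v x" "adjacent ?H v y" "x \<noteq> y"
    "\<And>S. tight_set 2 2 ?H S \<Longrightarrow> v \<notin> S \<Longrightarrow> \<not> {x, y} \<subseteq> S"
    using sparse_separable_neighbours[OF fin sparse, of v] assms(4,5) incident_eq by auto
  have verts: "x \<in> verts G - {v}" "y \<in> verts G - {v}"
    using xy(1,2) sparse_adjacent_verts[OF fin sparse order_refl] by auto
  obtain a where a: "a \<in> incident G v" using assms(5) by fastforce
  let ?G' = "add_edge (delete_vertex G v) a x y"
  have "adjacent G v x" "adjacent G v y" using xy(1,2) by (auto simp: adjacent_def)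
  then have "edge_split ?G' a v (incident G v) G"
    using a xy(3) assms(4) loopless finite_multigraphD(1)[OF assms(1)]
    by (intro edge_split_delete_vertex_add_edge) auto
  then have "move ?G' G" using assms(5) by (rule move_if_edge_split)
  moreover have "P21_graph ?G'"
    using assms a verts xy(4) by (rule P21_graph_delete_vertex_add_edge)
  moreover have "finite_multigraph ?G'"
    using verts by (intro finite_multigraph_add_edge finite_multigraph_delete_vertex assms(1)) auto
  ultimately show ?thesis by blast
qed

lemma P21_graph_reduce_end:
  assumes "finite_multigraph G" "e \<in> edges G" "tight 2 2 (delete_edge G e)"
    and "ends G e = {p, q}" "p \<noteq> q" "card (incident (delete_edge G e) p) = 2"
    and "adjacent (delete_edge G e) p x" "x \<noteq> q"
  shows "\<exists>G'. finite_multigraph G' \<and> P21_graph G' \<and> move G' G"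
proof -
  let ?H = "delete_edge G e"
  note fin = finite_multigraph_delete_edge[OF assms(1), of e]
  have sparse: "sparse 2 2 ?H" using assms(3) by (simp add: tight_def)
  have pq: "p \<in> verts G" "q \<in> verts G - {p}"
    using multigraph_ends_subset[OF finite_multigraphD(1)[OF assms(1)] assms(2)] assms(4,5) by auto
  have x: "x \<in> verts G - {p}"
    using sparse_adjacent_verts[OF fin sparse order_refl assms(7)] by simp
  have e: "e \<in> incident G p" using assms(2,4) by (auto simp: incident_def)
  have loopless: "card (ends G f) = 2" if "f \<in> incident G p" for f
    using that sparse_delete_edge_card_ends[OF assms(1) sparse order_refl, of f] assms(4,5)
    by (cases "f = e") (auto simp: incident_def)
  let ?G' = "add_edge (delete_vertex G p) e x q"
  have "adjacent G p x" "adjacent G p q" using assms(2,4,7) by (auto simp: adjacent_def)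
  then have "edge_split ?G' e p (incident G p) G"
    using assms(8) e pq loopless finite_multigraphD(1)[OF assms(1)]
    by (intro edge_split_delete_vertex_add_edge) auto
  moreover have "card (incident G p) = 3"
    using assms(6) card.remove[OF finite_incident[OF assms(1)] e]
    unfolding incident_delete_edge by linarith
  ultimately have "move ?G' G" by (rule move_if_edge_split)
  moreover have "P21_graph ?G'"
    using assms(1,3) e pq(1) assms(6) e x pq(2) by (rule P21_graph_delete_end_add_edge)
  moreover have "finite_multigraph ?G'"
    using x pq by (intro finite_multigraph_add_edge finite_multigraph_delete_vertex assms(1)) auto
  ultimately show ?thesis by blast
qed

lemma P21_graph_is_K23:
  assumes "finite_multigraph G" "e \<in> edges G" "tight 2 2 (delete_edge G e)"
    and "ends G e = {p, q}" "p \<noteq> q"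
    and "card (incident (delete_edge G e) p) = 2" "card (incident (delete_edge G e) q) = 2"
    and "\<And>x. adjacent (delete_edge G e) p x \<Longrightarrow> x = q"
  shows "is_K23 G"
proof -
  let ?H = "delete_edge G e"
  note fin = finite_multigraph_delete_edge[OF assms(1), of e]
  have pq: "{p, q} \<subseteq> verts ?H"
    using multigraph_ends_subset[OF finite_multigraphD(1)[OF assms(1)] assms(2)] assms(4) by simp
  have parallel: "ends G f = {p, q}" if f: "f \<in> incident ?H p" for f
  proof -
    obtain x where x: "ends ?H f = {p, x}"
      using incident_other_end[OF finite_multigraphD(1)[OF fin] f] by metis
    then have "adjacent ?H p x" using f unfolding adjacent_def incident_def by blast
    then show ?thesis using x assms(8) by simp
  qed
  then have "incident ?H p \<subseteq> incident ?H q" by (auto simp: incident_def)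
  then have incident_eq: "incident ?H p = incident ?H q"
    using assms(6,7) finite_incident[OF fin] by (intro card_subset_eq) auto
  have "{p, q} = verts ?H"
  proof (rule tight_no_separation[OF fin assms(3) _ _ pq])
    fix f assume f: "f \<in> edges ?H"
    then have "f \<in> incident ?H p \<or> ends ?H f \<inter> {p, q} = {}"
      using incident_eq by (auto simp: incident_def)
    then show "ends ?H f \<subseteq> {p, q} \<or> ends ?H f \<inter> {p, q} = {}" using parallel by auto
  qed auto
  then have verts: "verts G = {p, q}" by simp
  then have "card (edges ?H) = card (incident ?H p)"
    using assms(3,5,6) by (simp add: tight_iff_card)
  then have edges_eq: "edges ?H = incident ?H p"
    using finite_multigraphD(3)[OF fin]
    by (intro card_subset_eq[symmetric]) (auto simp: incident_def)
  obtain a b where ab: "incident ?H p = {a, b}" "a \<noteq> b" using assms(6) by (auto simp: card_2_iff)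
  have "edges G = {e, a, b}" "e \<noteq> a" "e \<noteq> b" using assms(2) edges_eq ab(1) by auto
  then show ?thesis unfolding is_K23_def using verts assms(4,5) ab parallel
    by - (rule exI[of _ p], rule exI[of _ q], rule exI[of _ e], rule exI[of _ a],
        rule exI[of _ b], auto)
qed

lemma P21_graph_reduce:
  assumes "finite_multigraph G" "P21_graph G" "card (verts G) \<ge> 2" "\<not> is_K23 G"
  shows "\<exists>G'. finite_multigraph G' \<and> P21_graph G' \<and> move G' G"
proof -
  obtain e where e: "e \<in> edges G" "tight 2 2 (delete_edge G e)"
    using assms(2) P21_graph_iff[OF assms(1)] by blast
  let ?H = "delete_edge G e"
  note fin = finite_multigraph_delete_edge[OF assms(1), of e]
  obtain p q where pq: "p \<in> verts G" "q \<in> verts G" "ends G e = {p, q}"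
    using multigraph_ends[OF finite_multigraphD(1)[OF assms(1)] e(1)] .
  consider (off_edge) v where "v \<in> verts G - ends G e" "card (incident ?H v) < 4"
    | (both_ends) "p \<noteq> q" "card (incident ?H p) = 2" "card (incident ?H q) = 2"
    using tight_small_degree_vertex[OF fin e(2), of p q] assms(3) pq by auto
  then show ?thesis
  proof cases
    case (off_edge v)
    have "verts G \<noteq> {v}" using assms(3) by auto
    then have "2 \<le> card (incident ?H v)"
      using off_edge(1) by (intro tight_card_incident_ge[OF fin e(2)]) auto
    then have "card (incident ?H v) = 2 \<or> card (incident ?H v) = 3" using off_edge(2) by linarith
    moreover have "incident ?H v = incident G v" using off_edge(1) by (auto simp: incident_def)
    ultimately have "card (incident G v) = 2 \<or> card (incident G v) = 3" by simp
    then show ?thesis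
      using P21_graph_reduce_degree_2[OF assms(1) e off_edge(1)]
        P21_graph_reduce_degree_3[OF assms(1) e off_edge(1)] by blast
  next
    case both_ends
    then obtain x where "adjacent ?H p x" "x \<noteq> q"
      using P21_graph_is_K23[OF assms(1) e pq(3)] assms(4) by blast
    then show ?thesis using P21_graph_reduce_end[OF assms(1) e pq(3)] both_ends by blast
  qed
qed

lemma P21_graph_is_K11:
  assumes "finite_multigraph G" "P21_graph G" "card (verts G) < 2"
  shows "is_K11 G"
proof -
  have "card (edges G) + 1 = 2 * card (verts G)"
    using assms(2) by (simp add: P21_graph_def tight_iff_card)
  moreover from this have "card (verts G) = 1" using assms(3) by linarith
  ultimately have "card (verts G) = 1" "card (edges G) = 1" by simp_all
  then obtain v e where ve: "verts G = {v}" "edges G = {e}" by (auto simp: card_1_singleton_iff)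
  then have "ends G e = {v}" using finite_multigraphD(1)[OF assms(1)] by (auto simp: multigraph_def)
  then show ?thesis using ve by (auto simp: is_K11_def)
qed

lemma move_card_verts:
  assumes "finite_multigraph G" "move G G'"
  shows "card (verts G) < card (verts G')"
  using assms(2)
proof (cases rule: move_cases)
  case (extension v F)
  then show ?thesis using finite_multigraphD(2)[OF assms(1)] by (simp add: vertex_extension_def)
next
  case (split d v F)
  then show ?thesis
    using finite_multigraphD(2)[OF assms(1)] by (simp add: edge_split_def vertex_extension_def)
qed

lemma constructible_move: "constructible G \<Longrightarrow> move G G' \<Longrightarrow> constructible G'"
  unfolding constructible_def by (meson rtranclp.rtrancl_into_rtrancl)

theorem P21_graph_constructible:
  assumes "finite_multigraph G" "P21_graph G"
  shows "constructible G"
  using assms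
proof (induction "card (verts G)" arbitrary: G rule: less_induct)
  case less
  consider "is_K11 G" | "is_K23 G" | (reducible) "card (verts G) \<ge> 2" "\<not> is_K23 G"
    using P21_graph_is_K11 less.prems by fastforce
  then show ?case
  proof cases
    case reducible
    then obtain G' where G': "finite_multigraph G'" "P21_graph G'" "move G' G"
      using P21_graph_reduce less.prems by blast
    then have "constructible G'" using less.hyps move_card_verts by blast
    then show ?thesis using G'(3) by (rule constructible_move)
  qed (auto simp: constructible_def)
qed

theorem theorem5p11:
  fixes G :: "('v, 'e) mgraph"
  assumes "finite_multigraph G"
  shows "(P21_graph G \<longleftrightarrow> constructible G) \<and>
         (constructible G \<longleftrightarrow> tree_map_decomposable G)"
proof -
  have "P21_graph G \<Longrightarrow> constructible G" by (rule P21_graph_constructible[OF assms])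
  moreover have "constructible G \<Longrightarrow> two_trees_plus_edge G"
    by (rule constructible_two_trees_plus_edge)
  moreover have "two_trees_plus_edge G \<Longrightarrow> P21_graph G"
    by (rule two_trees_plus_edge_P21_graph[OF assms])
  moreover have "tree_map_decomposable G \<longleftrightarrow> two_trees_plus_edge G"
    by (rule tree_map_decomposable_iff_two_trees_plus_edge[OF assms])
  ultimately show ?thesis by blast
qed

end
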